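(* Let $\lambda>0$, let $u_0\in H^s$ with $s>\frac32$, and let $T$ be the maximal existence time of the solution $u$ to the weakly dissipative $\mu$HS equation with initial data $u_0$. Put $\mu_0=\int_{\mathbb S}u_0\,dx$, $\mu_1=\left(\int_{\mathbb S}u_{0,x}^2\,dx\right)^{1/2}$ and $$K=2|\mu_0|\left(|\mu_0|+\tfrac{\sqrt3}{6}\mu_1\right).$$ If $$\inf_{x\in\mathbb S}u_0'(x)<-\lambda-\sqrt{\lambda^2+2K},$$ then the corresponding solution blows up in finite time.
   Context: $\mathbb S=\mathbb R/\mathbb Z$; functions on $\mathbb S$ are identified with 1-periodic functions on $\mathbb R$; $H^s=H^s(\mathbb S)$ (real-valued); $u_{0,x}=u_0'=\partial_xu_0$. $\mu(w)=\int_{\mathbb S}w\,dx$ and $A=\mu-\partial_x^2$ (i.e. $Aw=\mu(w)-w_{xx}$), an isomorphism $H^s\to H^{s-2}$. The weakly dissipative $\mu$HS equation is $y_t+uy_x+2u_xy+\lambda y=0$ for $t>0$, $x\in\mathbb R$, with $y=\mu(u)-u_{xx}$, $u(0,x)=u_0(x)$, $u(t,x+1)=u(t,x)$; equivalently $$u_t+uu_x=-\partial_xA^{-1}\left(2\mu_0e^{-\lambda t}u+\tfrac12u_x^2\right)-\lambda u,\qquad u(0,\cdot)=u_0,\quad \mu_0=\mu(u_0).$$ For $u_0\in H^s$, $s>\frac32$, there is a unique solution $u\in C([0,T);H^s)\cap C^1([0,T);H^{s-1})$ of this nonlocal form (as an equation in $H^{s-1}$), where $T=T(u_0)\in(0,\infty]$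 is the maximal existence time. "Blows up in finite time" means $T<\infty$. *)

theory Defs
  imports "HOL-Analysis.Analysis"
begin

text \<open>Functions on the circle \<open>\<real>/\<int>\<close> are 1-periodic functions on the real line.\<close>

definition fourier_coeff :: "(real \<Rightarrow> real) \<Rightarrow> int \<Rightarrow> complex" where
  "fourier_coeff f k =
     integral {0..1} (\<lambda>x. complex_of_real (f x) * cis (- 2 * pi * real_of_int k * x))"

definition sobolev_weight :: "real \<Rightarrow> int \<Rightarrow> real" where
  "sobolev_weight r k = (1 + (real_of_int k)\<^sup>2) powr r"

text \<open>The real-valued Sobolev space \<open>H^r\<close> of the circle. It is only meant for \<open>r > 1/2\<close>; by the
  Sobolev embedding every class then has exactly one continuous representative, and this
  representative stands for the class, so that equality in \<open>H^r\<close> is equality of functions.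
  For \<open>r > 3/2\<close> (resp. \<open>r > 5/2\<close>) the elements are \<open>C^1\<close> (resp. \<open>C^2\<close>), so the first
  (resp. second) distributional derivative is the classical one given by \<open>deriv\<close>.\<close>

definition sobolev :: "real \<Rightarrow> (real \<Rightarrow> real) set" where
  "sobolev r = {f. continuous_on UNIV f \<and> (\<forall>x. f (x + 1) = f x) \<and>
     (\<lambda>k. sobolev_weight r k * (cmod (fourier_coeff f k))\<^sup>2) summable_on UNIV}"

definition sobolev_norm :: "real \<Rightarrow> (real \<Rightarrow> real) \<Rightarrow> real" where
  "sobolev_norm r f =
     sqrt (\<Sum>\<^sub>\<infinity>k\<in>UNIV. sobolev_weight r k * (cmod (fourier_coeff f k))\<^sup>2)"

definition sobolev_continuous_on :: "real \<Rightarrow> real set \<Rightarrow> (real \<Rightarrow> real \<Rightarrow> real) \<Rightarrow> bool" where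
  "sobolev_continuous_on r I u \<longleftrightarrow>
     (\<forall>t\<in>I. u t \<in> sobolev r) \<and>
     (\<forall>t\<in>I. ((\<lambda>\<tau>. sobolev_norm r (\<lambda>x. u \<tau> x - u t x)) \<longlongrightarrow> 0) (at t within I))"

text \<open>\<open>u\<close> belongs to \<open>C^1(I; H^r)\<close> with time derivative \<open>v\<close> (one-sided at an endpoint of \<open>I\<close>).\<close>

definition sobolev_C1_on ::
  "real \<Rightarrow> real set \<Rightarrow> (real \<Rightarrow> real \<Rightarrow> real) \<Rightarrow> (real \<Rightarrow> real \<Rightarrow> real) \<Rightarrow> bool" where
  "sobolev_C1_on r I u v \<longleftrightarrow>
     sobolev_continuous_on r I u \<and> sobolev_continuous_on r I v \<and>
     (\<forall>t\<in>I. ((\<lambda>\<tau>. sobolev_norm r (\<lambda>x. (u \<tau> x - u t x) / (\<tau> - t) - v t x)) \<longlongrightarrow> 0)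
              (at t within I))"

definition mean :: "(real \<Rightarrow> real) \<Rightarrow> real" where
  "mean w = integral {0..1} w"

definition mu_op :: "(real \<Rightarrow> real) \<Rightarrow> real \<Rightarrow> real" where
  "mu_op w = (\<lambda>x. mean w - deriv (deriv w) x)"

text \<open>Inverse of the isomorphism \<open>A = mu_op\<close> from \<open>H^(r+2)\<close> onto \<open>H^r\<close>, for \<open>r > 1/2\<close>.\<close>

definition mu_op_inv :: "real \<Rightarrow> (real \<Rightarrow> real) \<Rightarrow> real \<Rightarrow> real" where
  "mu_op_inv r = inv_into (sobolev (r + 2)) mu_op"

definition muHS_rhs :: "real \<Rightarrow> real \<Rightarrow> real \<Rightarrow> real \<Rightarrow> (real \<Rightarrow> real) \<Rightarrow> real \<Rightarrow> real" where
  "muHS_rhs s lam m t w = (\<lambda>x.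
     - deriv (mu_op_inv (s - 1)
         (\<lambda>z. 2 * m * exp (- lam * t) * w z + 1 / 2 * (deriv w z)\<^sup>2)) x
     - lam * w x)"

text \<open>\<open>u\<close> is a solution on \<open>[0,T)\<close>, \<open>0 < T \<le> \<infinity>\<close>, in the class
  \<open>C([0,T); H^s) \<inter> C^1([0,T); H^(s-1))\<close>; its values at times outside \<open>[0,T)\<close> are irrelevant.\<close>

definition muHS_solution ::
  "real \<Rightarrow> real \<Rightarrow> (real \<Rightarrow> real) \<Rightarrow> ereal \<Rightarrow> (real \<Rightarrow> real \<Rightarrow> real) \<Rightarrow> bool" where
  "muHS_solution s lam u0 T u \<longleftrightarrow>
     0 < T \<and> u 0 = u0 \<and>
     sobolev_continuous_on s {t. 0 \<le> t \<and> ereal t < T} u \<and>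
     (\<exists>ut. sobolev_C1_on (s - 1) {t. 0 \<le> t \<and> ereal t < T} u ut \<and>
        (\<forall>t x. 0 \<le> t \<and> ereal t < T \<longrightarrow>
           ut t x + u t x * deriv (u t) x = muHS_rhs s lam (mean u0) t (u t) x))"

definition muHS_maximal_solution ::
  "real \<Rightarrow> real \<Rightarrow> (real \<Rightarrow> real) \<Rightarrow> ereal \<Rightarrow> (real \<Rightarrow> real \<Rightarrow> real) \<Rightarrow> bool" where
  "muHS_maximal_solution s lam u0 T u \<longleftrightarrow>
     muHS_solution s lam u0 T u \<and> (\<forall>T' v. muHS_solution s lam u0 T' v \<longrightarrow> T' \<le> T)"

end

theory Submission imports Defs begin

text \<open>If \<open>T\<close> were infinite, \<open>u\<close> would solve the equation for all times \<open>t \<ge> 0\<close>. Differentiating the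
  equation in \<open>x\<close> and using \<open>- \<partial>\<^sub>x\<^sup>2 A\<^sup>-\<^sup>1 g = g - mean g\<close> gives, formally,
  \<open>u\<^sub>t\<^sub>x + u u\<^sub>x\<^sub>x = - u\<^sub>x\<^sup>2 / 2 - \<lambda> u\<^sub>x + B\<close> with
  \<open>B = 2 \<mu>\<^sub>0 e\<^sup>-\<^sup>\<lambda>\<^sup>t (u - mean u) - \<integral> u\<^sub>x\<^sup>2 / 2\<close>. Since \<open>\<bar>u - mean u\<bar> \<le> \<integral> \<bar>u\<^sub>x\<bar>\<close>, the term
  satisfies \<open>B \<le> \<integral> (2 \<bar>\<mu>\<^sub>0\<bar> \<bar>u\<^sub>x\<bar> - u\<^sub>x\<^sup>2 / 2) \<le> 2 \<mu>\<^sub>0\<^sup>2 \<le> K\<close> (lemma \<open>muHS_source_bound\<close>). So the slope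
  obeys the Riccati inequality \<open>z' \<le> - z\<^sup>2 / 2 - \<lambda> z + K\<close>, and the hypothesis on the initial slope
  places it below the smaller root \<open>- \<lambda> - sqrt (\<lambda>\<^sup>2 + 2 K)\<close> of the right-hand side, where every
  solution is driven to \<open>-\<infinity>\<close> in finite time. This contradicts the boundedness of \<open>u\<^sub>x\<close> on compact
  time intervals.

  For \<open>s\<close> close to \<open>3/2\<close> the derivative \<open>u\<^sub>x\<^sub>x\<close> need not be a function. The inequality is therefore
  derived for difference quotients in \<open>x\<close>, at the point where the quotient is smallest (lemma
  \<open>steep_slope_excludes_global_solution\<close>). The derivation uses that \<open>u\<close> and \<open>u\<^sub>x\<close> are jointly continuous,
  that \<open>u\<close> is differentiable in \<open>t\<close> pointwise, and that the right-hand side is differentiable in \<open>x\<close>.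

  The rest of the development derives these classical properties from the Fourier description of
  the spaces. Uniqueness of Fourier coefficients (\<open>fourier_coeff_zero_imp_zero\<close>) gives Fourier
  inversion, from which come the sup-norm embedding (\<open>sobolev_sup_bound\<close>), classical derivatives
  for \<open>r > 3/2\<close> (\<open>sobolev_deriv\<close>), the algebra property for \<open>r > 1/2\<close> (\<open>sobolev_mult\<close>) and the
  surjectivity of \<open>A\<close> (\<open>mu_op_surj\<close>); the last two give \<open>A\<^sup>-\<^sup>1\<close> of \<open>2 \<mu>\<^sub>0 e\<^sup>-\<^sup>\<lambda>\<^sup>t u + u\<^sub>x\<^sup>2 / 2\<close> its intended
  meaning.\<close>

section \<open>Characters of the circle and uniqueness of Fourier coefficients\<close>

definition circle_char :: "int \<Rightarrow> real \<Rightarrow> complex" where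
  "circle_char k x = cis (2 * pi * real_of_int k * x)"

lemma circle_char_0 [simp]: "circle_char 0 x = 1"
  by (simp add: circle_char_def)

lemma norm_circle_char [simp]: "norm (circle_char k x) = 1"
  by (simp add: circle_char_def)

lemma cnj_circle_char [simp]: "cnj (circle_char k x) = circle_char (- k) x"
  by (simp add: circle_char_def cis_cnj)

lemma circle_char_mult: "circle_char j x * circle_char k x = circle_char (j + k) x"
  by (simp add: circle_char_def cis_mult algebra_simps)

lemma circle_char_int [simp]: "circle_char k (real_of_int n) = 1"
  using cis_multiple_2pi[of "real_of_int (k * n)"]
  by (simp add: circle_char_def mult.assoc)

lemma circle_char_1 [simp]: "circle_char k 1 = 1"
  using circle_char_int[of k 1] by simp

lemma circle_char_periodic: "circle_char k (x + 1) = circle_char k x"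
proof -
  have "circle_char k (x + 1) = circle_char k x * circle_char k 1"
    unfolding circle_char_def cis_mult distrib_left ..
  then show ?thesis by simp
qed

lemma continuous_on_circle_char [continuous_intros]: "continuous_on S (circle_char k)"
  unfolding circle_char_def by (intro continuous_intros)

lemma circle_char_has_vector_derivative:
  "(circle_char k has_vector_derivative 2 * pi * \<i> * of_int k * circle_char k x) (at x within S)"
proof -
  have "((\<lambda>z. exp (2 * pi * \<i> * of_int k * z)) has_field_derivative 
      2 * pi * \<i> * of_int k * exp (2 * pi * \<i> * of_int k * of_real x)) (at (of_real x))"
    by (auto intro!: derivative_eq_intros)
  from has_vector_derivative_real_field[OF this] show ?thesis
    by (simp add: circle_char_def[abs_def] cis_conv_exp mult_ac)
qed

lemma circle_char_integral:
  "((circle_char k) has_integral (if k = 0 then 1 else 0)) {0..1}"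
proof (cases "k = 0")
  case True
  have "((\<lambda>x::real. 1::complex) has_integral 1) {0..1}"
    using has_integral_const_real[of "1::complex" 0 1] by simp
  with True show ?thesis by (simp add: circle_char_def[abs_def])
next
  case False
  let ?c = "2 * pi * \<i> * of_int k :: complex"
  have c: "?c \<noteq> 0" using False by simp
  have "(circle_char k has_integral (circle_char k 1 / ?c - circle_char k 0 / ?c)) {0..1}"
  proof (rule fundamental_theorem_of_calculus)
    fix x :: real
    show "((\<lambda>x. circle_char k x / ?c) has_vector_derivative circle_char k x) (at x within {0..1})"
      using has_vector_derivative_divide[OF circle_char_has_vector_derivative[of k x "{0..1}"], of ?c] c
      by simp
  qed simp
  then show ?thesis using False circle_char_int[of k 0] by simp
qed

lemma fourier_coeff_eq:
  "fourier_coeff f k = integral {0..1} (\<lambda>x. complex_of_real (f x) * circle_char (- k) x)"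
  by (simp add: fourier_coeff_def circle_char_def)

text \<open>A class of functions closed under products that contains the characters: orthogonality of a
  function to all characters then passes to everything that the Stone--Weierstrass theorem builds
  on the unit circle.\<close>

inductive trig_poly :: "(real \<Rightarrow> complex) \<Rightarrow> bool" where
  char: "trig_poly (\<lambda>x. c * circle_char k x)"
| add: "trig_poly p \<Longrightarrow> trig_poly q \<Longrightarrow> trig_poly (\<lambda>x. p x + q x)"

lemma trig_poly_mult:
  assumes "trig_poly p" "trig_poly q"
  shows "trig_poly (\<lambda>x. p x * q x)"
  using assms(1)
proof induction
  case (char c k)
  show ?case using assms(2)
  proof induction
    case (char d l)
    have "(\<lambda>x. c * circle_char k x * (d * circle_char l x)) = (\<lambda>x. (c * d) * circle_char (k + l) x)"
      by (simp add: fun_eq_iff flip: circle_char_mult)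
    then show ?case using trig_poly.char by metis
  next
    case (add p q)
    then show ?case by (simp add: distrib_left trig_poly.add)
  qed
next
  case (add p p')
  then show ?case by (simp add: distrib_right trig_poly.add)
qed

lemma trig_poly_of_real_polynomial_function:
  fixes p :: "complex \<Rightarrow> real"
  assumes "real_polynomial_function p"
  shows "trig_poly (\<lambda>x. complex_of_real (p (circle_char 1 x)))"
  using assms
proof induction
  case (linear L)
  interpret bounded_linear L by fact
  define a where "a = (of_real (L 1) - \<i> * of_real (L \<i>)) / 2"
  define b where "b = (of_real (L 1) + \<i> * of_real (L \<i>)) / 2"
  have "of_real (L z) = a * z + b * cnj z" for z
  proof -
    have "z = Re z *\<^sub>R 1 + Im z *\<^sub>R \<i>" by (simp add: complex_eq_iff)
    then have "L z = L (Re z *\<^sub>R 1 + Im z *\<^sub>R \<i>)" by (rule arg_cong)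
    also have "\<dots> = Re z * L 1 + Im z * L \<i>" by (simp only: add scaleR) simp
    finally show ?thesis
      by (simp add: a_def b_def complex_eq_iff) (simp add: field_simps)
  qed
  then have "(\<lambda>x. complex_of_real (L (circle_char 1 x)))
      = (\<lambda>x. a * circle_char 1 x + b * circle_char (-1) x)"
    by simp
  then show ?case by (simp only: trig_poly.add[OF trig_poly.char trig_poly.char])
next
  case (const c)
  show ?case using trig_poly.char[of "of_real c" 0] by simp
next
  case (add p q)
  then show ?case by (simp add: trig_poly.add)
next
  case (mult p q)
  then show ?case by (simp add: trig_poly_mult)
qed

lemma periodic_frac:
  fixes f :: "real \<Rightarrow> 'a"
  assumes "\<And>x. f (x + 1) = f x"
  shows "f (frac x) = f x"
proof -
  have up: "f (x + real n) = f x" for x n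
  proof (induction n)
    case (Suc n)
    then show ?case using assms[of "x + real n"] by (simp add: add_ac)
  qed simp
  have "f (x + of_int m) = f x" for x m
  proof (cases "m \<ge> 0")
    case True
    then show ?thesis using up[of x "nat m"] by simp
  next
    case False
    then show ?thesis using up[of "x + of_int m" "nat (- m)"] by simp
  qed
  from this[of x "- floor x"] show ?thesis by (simp add: frac_def)
qed

text \<open>The map from \<open>[0,1]\<close> onto the unit circle glues only \<open>0\<close> to \<open>1\<close>, so a periodic function descends
  to the circle. Continuity of the descended function holds because the map is closed: it is
  continuous on a compact interval.\<close>

lemma periodic_function_on_circle:
  fixes f :: "real \<Rightarrow> real"
  assumes f: "continuous_on UNIV f" and per: "\<And>x. f (x + 1) = f x"
  obtains F where "continuous_on (circle_char 1 ` {0..1}) F" "\<And>x. x \<in> {0..1} \<Longrightarrow> F (circle_char 1 x) = f x"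
proof -
  have inj: "f x = f y" if "circle_char 1 x = circle_char 1 y" for x y
  proof -
    from that have "exp (2 * pi * \<i> * x) = exp (2 * pi * \<i> * y)"
      by (simp add: circle_char_def cis_conv_exp mult_ac)
    then obtain m :: int where "2 * pi * \<i> * x = 2 * pi * \<i> * y + 2 * of_int m * pi * \<i>"
      by (auto simp: exp_eq)
    then have "2 * pi * x = 2 * pi * y + 2 * pi * of_int m"
      by (simp add: complex_eq_iff mult_ac)
    then have m: "x = y + of_int m" by (simp flip: distrib_left)
    then have "frac x = frac y" by simp
    then show ?thesis using periodic_frac[of f] per by metis
  qed
  define F where "F z = f (SOME x. circle_char 1 x = z)" for z
  have F: "F (circle_char 1 x) = f x" for x
    unfolding F_def by (rule inj, rule someI[of _ x]) simp
  have "continuous_on (circle_char 1 ` {0..1}) F"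
    unfolding continuous_on_closed_invariant
  proof safe
    fix B :: "real set" assume B: "closed B"
    let ?A = "circle_char 1 ` ({0..1} \<inter> f -` B)"
    have "compact ({0..1} \<inter> f -` B)"
      using B f by (intro compact_Int_closed) (auto simp: continuous_on_eq_continuous_at closed_vimage continuous_at_imp_continuous_on)
    then have "compact ?A"
      by (intro compact_continuous_image continuous_on_circle_char)
    moreover have "?A \<inter> circle_char 1 ` {0..1} = F -` B \<inter> circle_char 1 ` {0..1}"
      by (auto simp: F) (metis inj)
    ultimately show "\<exists>A. closed A \<and> A \<inter> circle_char 1 ` {0..1} = F -` B \<inter> circle_char 1 ` {0..1}"
      using compact_imp_closed by blast
  qed
  then show thesis using F that by blast
qed

lemma integrable_mult_circle_char:
  assumes "continuous_on {0..1} (f :: real \<Rightarrow> real)"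
  shows "(\<lambda>x. complex_of_real (f x) * circle_char k x) integrable_on {0..1}"
  by (intro integrable_continuous_real continuous_intros assms)

text \<open>A real polynomial in the point of the circle is a trigonometric polynomial, hence orthogonal to
  \<open>f\<close>. Approximating \<open>f\<close> by such polynomials within \<open>e\<close> bounds the square integral of \<open>f\<close> by
  \<open>e\<close> times the integral of its modulus, for every \<open>e > 0\<close>.\<close>

lemma fourier_coeff_zero_imp_zero:
  fixes f :: "real \<Rightarrow> real"
  assumes f: "continuous_on UNIV f" and per: "\<And>x. f (x + 1) = f x"
    and zero: "\<And>k. fourier_coeff f k = 0"
  shows "f x = 0"
proof -
  have f01: "continuous_on {0..1} f" using f continuous_on_subset by blast
  have cp: "continuous_on {0..1} p \<and> integral {0..1} (\<lambda>x. of_real (f x) * p x) = 0" if "trig_poly p" for p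
    using that
  proof induction
    case (char c k)
    have "integral {0..1} (\<lambda>x. c * (of_real (f x) * circle_char k x)) = 0"
      using zero[of "- k"] by (simp add: fourier_coeff_eq)
    then show ?case by (auto intro!: continuous_intros simp: mult_ac)
  next
    case (add p q)
    then have "integral {0..1} (\<lambda>x. of_real (f x) * p x + of_real (f x) * q x) = 0"
      by (subst integral_add) (auto intro!: integrable_continuous_real continuous_intros f01)
    with add show ?case by (auto intro!: continuous_intros simp: distrib_left)
  qed
  obtain F where F: "continuous_on (circle_char 1 ` {0..1}) F" "\<And>x. x \<in> {0..1} \<Longrightarrow> F (circle_char 1 x) = f x"
    using periodic_function_on_circle f per by blast
  have cf2: "continuous_on {0..1} (\<lambda>x. f x * f x)" by (intro continuous_intros f01)
  have le: "integral {0..1} (\<lambda>x. f x * f x) \<le> e * integral {0..1} (\<lambda>x. \<bar>f x\<bar>)" if e: "e > 0" for e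
  proof -
    obtain g where g: "real_polynomial_function g" "\<And>z. z \<in> circle_char 1 ` {0..1} \<Longrightarrow> \<bar>F z - g z\<bar> < e"
      using Stone_Weierstrass_real_polynomial_function[OF _ F(1) e]
      by (metis compact_Icc compact_continuous_image continuous_on_circle_char)
    define p where "p x = g (circle_char 1 x)" for x
    note tp = cp[OF trig_poly_of_real_polynomial_function[OF g(1)], folded p_def]
    have "continuous_on {0..1} (\<lambda>x. Re (complex_of_real (p x)))"
      using tp by (intro continuous_intros) auto
    then have p: "continuous_on {0..1} p" by simp
    have "integral {0..1} (\<lambda>x. complex_of_real (f x * p x)) = of_real (integral {0..1} (\<lambda>x. f x * p x))"
      by (rule integral_linear[OF _ bounded_linear_of_real, unfolded o_def]) (intro integrable_continuous_real continuous_intros f01 p)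
    then have 0: "integral {0..1} (\<lambda>x. f x * p x) = 0" using tp by simp
    have "integral {0..1} (\<lambda>x. f x * f x) = integral {0..1} (\<lambda>x. f x * f x) - integral {0..1} (\<lambda>x. f x * p x)"
      using 0 by simp
    also have "\<dots> = integral {0..1} (\<lambda>x. f x * f x - f x * p x)"
      by (rule integral_diff[symmetric]; intro integrable_continuous_real continuous_intros f01 p)
    also have "\<dots> \<le> integral {0..1} (\<lambda>x. e * \<bar>f x\<bar>)"
    proof (rule integral_le)
      fix x :: real assume x: "x \<in> {0..1}"
      have "f x * f x - f x * p x \<le> \<bar>f x * (f x - p x)\<bar>" by (simp add: algebra_simps)
      also have "\<dots> = \<bar>f x\<bar> * \<bar>f x - p x\<bar>" by (simp add: abs_mult)
      also have "\<dots> \<le> \<bar>f x\<bar> * e"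
        using g(2)[of "circle_char 1 x"] F(2)[OF x] x by (intro mult_left_mono) (auto simp: p_def)
      finally show "f x * f x - f x * p x \<le> e * \<bar>f x\<bar>" by (simp add: mult.commute)
    qed (intro integrable_continuous_real continuous_intros f01 p)+
    finally show ?thesis by simp
  qed
  define C where "C = integral {0..1} (\<lambda>x. \<bar>f x\<bar>)"
  have C: "C \<ge> 0" unfolding C_def by (rule integral_nonneg) (auto intro!: integrable_continuous_real continuous_intros f01)
  have "integral {0..1} (\<lambda>x. f x * f x) \<le> 0"
  proof (rule field_le_epsilon)
    fix e :: real assume "e > 0"
    then have "integral {0..1} (\<lambda>x. f x * f x) \<le> e / (C + 1) * C" using le[of "e / (C + 1)"] C by (simp add: C_def)
    also have "\<dots> \<le> e" using C \<open>e > 0\<close> by (simp add: field_simps)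
    finally show "integral {0..1} (\<lambda>x. f x * f x) \<le> 0 + e" by simp
  qed
  moreover have "integral {0..1} (\<lambda>x. f x * f x) \<ge> 0"
    by (rule integral_nonneg) (auto intro!: integrable_continuous_real cf2)
  ultimately have "\<forall>x\<in>{0..1}. f x * f x = 0"
    using integral_eq_0_iff[OF cf2] by simp
  then have "f (frac x) = 0" by (simp add: frac_ge_0 less_imp_le[OF frac_lt_1])
  then show ?thesis using periodic_frac[of f x] per by metis
qed

section \<open>Absolutely convergent Fourier series\<close>

text \<open>The series converges uniformly by the Weierstrass test, which lets continuity and integrals
  pass through the sum. The free factor \<open>G\<close> serves three purposes: a character gives the
  coefficients of the sum, the constant \<open>1\<close> gives its antiderivative, and a second function gives
  the coefficients of a product.\<close>

lemma fourier_series_termwise: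
  fixes a :: "int \<Rightarrow> complex" and S :: "real \<Rightarrow> complex"
  assumes a: "(\<lambda>k. norm (a k)) summable_on UNIV"
    and S: "\<And>x. ((\<lambda>k. a k * circle_char k x) has_sum S x) UNIV"
  shows fourier_series_continuous: "continuous_on UNIV S"
    and fourier_series_integral: "continuous_on {p..q} G \<Longrightarrow>
      ((\<lambda>k. a k * integral {p..q} (\<lambda>x. circle_char k x * G x)) has_sum integral {p..q} (\<lambda>x. S x * G x)) UNIV"
proof -
  have "uniform_limit UNIV (\<lambda>X x. \<Sum>k\<in>X. a k * circle_char k x) S (finite_subsets_at_top UNIV)"
    by (rule Weierstrass_m_test_general'[OF _ S a]) (simp add: norm_mult)
  then show "continuous_on UNIV S"
    by (rule uniform_limit_theorem[rotated])
      (auto intro!: always_eventually continuous_intros)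
  assume G: "continuous_on {p..q} G"
  obtain M where M: "norm (G x) \<le> M" if "x \<in> {p..q}" for x
    using compact_imp_bounded[OF compact_continuous_image[OF G compact_Icc]]
    unfolding bounded_iff by blast
  have ul: "uniform_limit {p..q} (\<lambda>X x. \<Sum>k\<in>X. a k * circle_char k x * G x) (\<lambda>x. S x * G x) (finite_subsets_at_top UNIV)"
  proof (rule Weierstrass_m_test_general')
    show "norm (a k * circle_char k x * G x) \<le> norm (a k) * M" if "x \<in> {p..q}" for k x
      using M[OF that] by (simp add: norm_mult mult_left_mono)
    show "(\<lambda>k. norm (a k) * M) summable_on UNIV"
      by (rule summable_on_cmult_left[OF a])
  qed (rule has_sum_cmult_left[OF S])
  have co: "continuous_on {p..q} (\<lambda>x. \<Sum>k\<in>X. a k * circle_char k x * G x)" for X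
    by (intro continuous_intros G)
  obtain I J where IJ: "\<And>X. ((\<lambda>x. \<Sum>k\<in>X. a k * circle_char k x * G x) has_integral I X) {p..q}"
      "((\<lambda>x. S x * G x) has_integral J) {p..q}" "(I \<longlongrightarrow> J) (finite_subsets_at_top UNIV)"
    by (rule uniform_limit_integral[OF ul co]) auto
  have "I X = (\<Sum>k\<in>X. a k * integral {p..q} (\<lambda>x. circle_char k x * G x))" if "finite X" for X
  proof -
    have "I X = integral {p..q} (\<lambda>x. \<Sum>k\<in>X. a k * circle_char k x * G x)"
      using integral_unique[OF IJ(1)] by simp
    also have "\<dots> = (\<Sum>k\<in>X. integral {p..q} (\<lambda>x. a k * circle_char k x * G x))"
      by (intro integral_sum that integrable_continuous_real continuous_intros G)
    finally show ?thesis by (simp add: mult.assoc)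
  qed
  then have "((\<lambda>X. \<Sum>k\<in>X. a k * integral {p..q} (\<lambda>x. circle_char k x * G x)) \<longlongrightarrow> J) (finite_subsets_at_top UNIV)"
    using IJ(3) by (subst tendsto_cong[of _ I]) (auto intro!: eventually_finite_subsets_at_top_weakI)
  then show "((\<lambda>k. a k * integral {p..q} (\<lambda>x. circle_char k x * G x)) has_sum integral {p..q} (\<lambda>x. S x * G x)) UNIV"
    using IJ(2) by (simp add: has_sum_def integral_unique)
qed

lemma fourier_coeff_cnj: "fourier_coeff f (- k) = cnj (fourier_coeff f k)"
  by (simp add: fourier_coeff_eq integral_cnj)

text \<open>The symmetry condition says that conjugating the series and reversing its index give the same
  series, so the sum is real.\<close>

lemma real_function_with_coeffs:
  fixes a :: "int \<Rightarrow> complex"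
  assumes a: "(\<lambda>k. norm (a k)) summable_on UNIV" and sym: "\<And>k. a (- k) = cnj (a k)"
  obtains f :: "real \<Rightarrow> real"
  where "continuous_on UNIV f" "\<And>x. f (x + 1) = f x" "\<And>k. fourier_coeff f k = a k"
    "\<And>x. ((\<lambda>k. a k * circle_char k x) has_sum complex_of_real (f x)) UNIV"
proof -
  define S where "S x = (\<Sum>\<^sub>\<infinity>k. a k * circle_char k x)" for x
  have S: "((\<lambda>k. a k * circle_char k x) has_sum S x) UNIV" for x
    unfolding S_def by (rule has_sum_infsum, rule abs_summable_summable) (simp add: norm_mult a)
  have "cnj (S x) = S x" for x
  proof -
    have "((\<lambda>k. a (- k) * circle_char (- k) x) has_sum S x) UNIV"
      using S[of x] by (subst has_sum_reindex_bij_betw[where g = uminus and f = "\<lambda>k. a k * circle_char k x" and B = UNIV]) (auto simp: bij_uminus)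
    moreover have "((\<lambda>k. cnj (a k * circle_char k x)) has_sum cnj (S x)) UNIV"
      using S by (simp only: has_sum_cnj_iff)
    ultimately show ?thesis
      by (simp add: sym has_sum_unique)
  qed
  then have SR: "of_real (Re (S x)) = S x" for x
    by (metis Reals_cnj_iff of_real_Re)
  have contS: "continuous_on UNIV S" by (rule fourier_series_continuous[OF a S])
  show thesis
  proof
    show "continuous_on UNIV (\<lambda>x. Re (S x))" by (intro continuous_intros contS)
    show "Re (S (x + 1)) = Re (S x)" for x by (simp add: S_def circle_char_periodic)
    show "((\<lambda>k. a k * circle_char k x) has_sum complex_of_real (Re (S x))) UNIV" for x
      using S by (simp add: SR)
    fix l
    have "((\<lambda>k. a k * integral {0..1} (\<lambda>x. circle_char k x * circle_char (- l) x)) has_sum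
        integral {0..1} (\<lambda>x. S x * circle_char (- l) x)) UNIV"
      by (rule fourier_series_integral[OF a S]) (intro continuous_intros)
    moreover have "integral {0..1} (\<lambda>x. circle_char k x * circle_char (- l) x) = (if k = l then 1 else 0)" for k
      using integral_unique[OF circle_char_integral[of "k - l"]] by (simp add: circle_char_mult)
    ultimately have "((\<lambda>k. if k = l then a l else 0) has_sum fourier_coeff (\<lambda>x. Re (S x)) l) UNIV"
      by (simp add: fourier_coeff_eq SR if_distrib cong: if_cong)
    moreover have "((\<lambda>k. if k = l then a l else 0) has_sum a l) UNIV"
      by (rule has_sum_finite_neutralI[of "{l}"]) auto
    ultimately show "fourier_coeff (\<lambda>x. Re (S x)) l = a l"
      by (rule has_sum_unique)
  qed
qed

lemma fourier_coeff_add: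
  assumes "continuous_on UNIV f" "continuous_on UNIV g"
  shows "fourier_coeff (\<lambda>x. f x + g x) k = fourier_coeff f k + fourier_coeff g k"
  unfolding fourier_coeff_eq
  by (subst integral_add[symmetric])
    (auto intro!: integrable_mult_circle_char continuous_on_subset[OF assms(1)] continuous_on_subset[OF assms(2)] simp: distrib_right)

lemma fourier_coeff_cmult: "fourier_coeff (\<lambda>x. c * f x) k = of_real c * fourier_coeff f k"
  by (simp add: fourier_coeff_eq mult.assoc)

lemma fourier_coeff_diff:
  assumes "continuous_on UNIV f" "continuous_on UNIV g"
  shows "fourier_coeff (\<lambda>x. f x - g x) k = fourier_coeff f k - fourier_coeff g k"
  using fourier_coeff_add[OF assms(1) continuous_on_mult_left[OF assms(2), of "-1"], of k]
  by (simp add: fourier_coeff_cmult del: mult_minus_left) (simp add: fourier_coeff_cmult[of "-1", simplified])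

lemma fourier_coeff_const: "fourier_coeff (\<lambda>x. c) k = (if k = 0 then of_real c else 0)"
  using integral_unique[OF circle_char_integral[of "- k"]] by (simp add: fourier_coeff_eq)

lemma fourier_coeff_eq_imp_eq:
  fixes f g :: "real \<Rightarrow> real"
  assumes "continuous_on UNIV f" "\<And>x. f (x + 1) = f x" "continuous_on UNIV g" "\<And>x. g (x + 1) = g x"
    and "\<And>k. fourier_coeff f k = fourier_coeff g k"
  shows "f = g"
proof
  fix x
  have "f x - g x = 0"
    by (rule fourier_coeff_zero_imp_zero[of "\<lambda>x. f x - g x"])
      (auto intro!: continuous_intros assms simp: fourier_coeff_diff assms)
  then show "f x = g x" by simp
qed

text \<open>The sum of the Fourier series is a continuous function with the same coefficients as \<open>f\<close>, so it is
  \<open>f\<close> by uniqueness.\<close>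

lemma fourier_inversion:
  fixes f :: "real \<Rightarrow> real"
  assumes f: "continuous_on UNIV f" "\<And>x. f (x + 1) = f x"
    and sm: "(\<lambda>k. norm (fourier_coeff f k)) summable_on UNIV"
  shows "((\<lambda>k. fourier_coeff f k * circle_char k x) has_sum complex_of_real (f x)) UNIV"
proof -
  obtain g where g: "continuous_on UNIV g" "\<And>x. g (x + 1) = g x" "\<And>k. fourier_coeff g k = fourier_coeff f k"
    "\<And>x. ((\<lambda>k. fourier_coeff f k * circle_char k x) has_sum complex_of_real (g x)) UNIV"
    using real_function_with_coeffs[OF sm fourier_coeff_cnj] by metis
  have "f = g" by (rule fourier_coeff_eq_imp_eq[OF f g(1,2)]) (simp add: g(3))
  with g(4) show ?thesis by simp
qed

section \<open>Sobolev spaces on the circle\<close>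

lemma sobolev_weight_pos: "sobolev_weight r k > 0"
  unfolding sobolev_weight_def powr_gt_zero by (smt (verit) zero_le_power2)

lemma sobolev_weight_nonneg [simp]: "sobolev_weight r k \<ge> 0"
  using sobolev_weight_pos less_imp_le by blast

lemma sobolev_weight_add: "sobolev_weight r k * sobolev_weight q k = sobolev_weight (r + q) k"
  by (simp add: sobolev_weight_def powr_add)

lemma sobolev_weight_0 [simp]: "sobolev_weight 0 k = 1"
proof -
  have "0 < 1 + (real_of_int k)\<^sup>2" by (simp add: add_pos_nonneg)
  then show ?thesis by (simp add: sobolev_weight_def)
qed

lemma sobolev_weight_1: "sobolev_weight 1 k = 1 + (real_of_int k)\<^sup>2"
  by (simp add: sobolev_weight_def add_pos_nonneg)

lemma sobolev_weight_mono: "r \<le> q \<Longrightarrow> sobolev_weight r k \<le> sobolev_weight q k"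
  by (simp add: sobolev_weight_def powr_mono)

lemma sobolev_weight_summable:
  assumes r: "r > 1/2"
  shows "sobolev_weight (- r) summable_on UNIV"
proof -
  have *: "(\<lambda>n::nat. (1 + (real n)\<^sup>2) powr (- r)) summable_on UNIV"
  proof (rule summable_nonneg_imp_summable_on)
    show "summable (\<lambda>n. (1 + (real n)\<^sup>2) powr (- r))"
    proof (rule summable_comparison_test')
      show "summable (\<lambda>n. real n powr (- 2 * r))"
        using r by (simp add: summable_real_powr_iff)
      fix n :: nat assume n: "n \<ge> 1"
      have "(1 + (real n)\<^sup>2) powr (- r) \<le> ((real n)\<^sup>2) powr (- r)"
        using n r by (intro powr_mono2') auto
      also have "\<dots> = real n powr (- 2 * r)"
        using n by (simp add: powr_powr flip: powr_numeral)
      finally show "norm ((1 + (real n)\<^sup>2) powr (- r)) \<le> real n powr (- 2 * r)" by simp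
    qed
  qed auto
  have "sobolev_weight (- r) summable_on (range int)"
    by (subst summable_on_reindex) (use * in \<open>auto simp: sobolev_weight_def o_def\<close>)
  moreover have "sobolev_weight (- r) summable_on (range (\<lambda>n. - int n))"
    by (subst summable_on_reindex) (use * in \<open>auto simp: sobolev_weight_def o_def inj_on_def\<close>)
  moreover have "range int \<union> range (\<lambda>n. - int n) = UNIV"
  proof (intro equalityI subset_UNIV subsetI)
    fix k :: int
    show "k \<in> range int \<union> range (\<lambda>n. - int n)"
      by (cases k rule: int_cases2) auto
  qed
  ultimately show ?thesis by (metis summable_on_union)
qed

text \<open>The constant that the Cauchy--Schwarz inequality gives for the embedding of \<open>H^r\<close> into the
  continuous functions, for \<open>r > 1/2\<close>.\<close>

definition embedding_const :: "real \<Rightarrow> real" where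
  "embedding_const r = sqrt (\<Sum>\<^sub>\<infinity>k. sobolev_weight (- r) k)"

lemma weighted_l2_imp_l1:
  fixes a :: "int \<Rightarrow> complex"
  assumes r: "r > 1/2" and a: "(\<lambda>k. sobolev_weight r k * (cmod (a k))\<^sup>2) summable_on UNIV"
  shows weighted_l2_imp_summable: "(\<lambda>k. norm (a k)) summable_on UNIV"
    and weighted_l2_imp_bound: "(\<Sum>\<^sub>\<infinity>k. norm (a k)) \<le> embedding_const r * sqrt (\<Sum>\<^sub>\<infinity>k. sobolev_weight r k * (cmod (a k))\<^sup>2)"
proof -
  let ?C = "embedding_const r * sqrt (\<Sum>\<^sub>\<infinity>k. sobolev_weight r k * (cmod (a k))\<^sup>2)"
  have fin: "(\<Sum>k\<in>F. norm (a k)) \<le> ?C" if F: "finite F" for F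
  proof -
    have "(\<Sum>k\<in>F. norm (a k)) = (\<Sum>k\<in>F. sobolev_weight (- r / 2) k * (sobolev_weight (r / 2) k * norm (a k)))"
    proof (rule sum.cong)
      fix k
      have "sobolev_weight (- r / 2) k * sobolev_weight (r / 2) k = 1"
        unfolding sobolev_weight_add by simp
      then show "norm (a k) = sobolev_weight (- r / 2) k * (sobolev_weight (r / 2) k * norm (a k))"
        by (metis mult.assoc mult_1)
    qed simp
    also have "\<dots> \<le> sqrt ((\<Sum>k\<in>F. (sobolev_weight (- r / 2) k)\<^sup>2) * (\<Sum>k\<in>F. (sobolev_weight (r / 2) k * norm (a k))\<^sup>2))"
      by (intro real_le_rsqrt Cauchy_Schwarz_ineq_sum)
    also have "\<dots> = sqrt (\<Sum>k\<in>F. sobolev_weight (- r) k) * sqrt (\<Sum>k\<in>F. sobolev_weight r k * (cmod (a k))\<^sup>2)"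
      by (simp only: real_sqrt_mult power_mult_distrib power2_eq_square[of "sobolev_weight _ _"] sobolev_weight_add) simp
    also have "\<dots> \<le> ?C"
      unfolding embedding_const_def
      by (intro mult_mono real_sqrt_le_mono finite_sum_le_infsum sobolev_weight_summable r a F)
        (auto intro!: sum_nonneg infsum_nonneg)
    finally show ?thesis .
  qed
  show 1: "(\<lambda>k. norm (a k)) summable_on UNIV"
    by (rule nonneg_bounded_partial_sums_imp_summable_on[where C = ?C])
      (auto intro!: eventually_finite_subsets_at_top_weakI fin)
  show "(\<Sum>\<^sub>\<infinity>k. norm (a k)) \<le> ?C"
    by (rule infsum_le_finite_sums[OF 1]) (use fin in auto)
qed

lemma sobolevD:
  assumes "f \<in> sobolev r"
  shows "continuous_on UNIV f" "\<And>x. f (x + 1) = f x"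
    "(\<lambda>k. sobolev_weight r k * (cmod (fourier_coeff f k))\<^sup>2) summable_on UNIV"
  using assms by (auto simp: sobolev_def)

lemma sobolev_mono:
  assumes "r \<le> q" "f \<in> sobolev q"
  shows "f \<in> sobolev r"
proof -
  have "(\<lambda>k. sobolev_weight r k * (cmod (fourier_coeff f k))\<^sup>2) summable_on UNIV"
    by (rule summable_on_comparison_test[OF sobolevD(3)[OF assms(2)]])
      (auto intro!: mult_right_mono sobolev_weight_mono assms)
  then show ?thesis using sobolevD[OF assms(2)] by (simp add: sobolev_def)
qed

lemma sobolev_cmult:
  assumes "f \<in> sobolev r"
  shows "(\<lambda>x. c * f x) \<in> sobolev r"
proof -
  have "(\<lambda>k. c\<^sup>2 * (sobolev_weight r k * (cmod (fourier_coeff f k))\<^sup>2)) summable_on UNIV"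
    by (rule summable_on_cmult_right[OF sobolevD(3)[OF assms]])
  then show ?thesis using sobolevD[OF assms]
    by (auto simp: sobolev_def fourier_coeff_cmult norm_mult power_mult_distrib mult_ac intro!: continuous_intros)
qed

lemma sobolev_add:
  assumes "f \<in> sobolev r" "g \<in> sobolev r"
  shows "(\<lambda>x. f x + g x) \<in> sobolev r"
proof -
  have "(\<lambda>k. 2 * (sobolev_weight r k * (cmod (fourier_coeff f k))\<^sup>2)
      + 2 * (sobolev_weight r k * (cmod (fourier_coeff g k))\<^sup>2)) summable_on UNIV"
    by (intro summable_on_add summable_on_cmult_right sobolevD(3) assms)
  then have "(\<lambda>k. sobolev_weight r k * (cmod (fourier_coeff f k + fourier_coeff g k))\<^sup>2) summable_on UNIV"
  proof (rule summable_on_comparison_test)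
    fix k
    have "(cmod (fourier_coeff f k + fourier_coeff g k))\<^sup>2 \<le> (cmod (fourier_coeff f k) + cmod (fourier_coeff g k))\<^sup>2"
      by (intro power_mono norm_triangle_ineq norm_ge_zero)
    also have "\<dots> \<le> 2 * (cmod (fourier_coeff f k))\<^sup>2 + 2 * (cmod (fourier_coeff g k))\<^sup>2"
      using sum_squares_bound[of "cmod (fourier_coeff f k)" "cmod (fourier_coeff g k)"]
      by (simp add: power2_sum)
    finally have "sobolev_weight r k * (cmod (fourier_coeff f k + fourier_coeff g k))\<^sup>2
       \<le> sobolev_weight r k * (2 * (cmod (fourier_coeff f k))\<^sup>2 + 2 * (cmod (fourier_coeff g k))\<^sup>2)"
      by (intro mult_left_mono) auto
    then show "sobolev_weight r k * (cmod (fourier_coeff f k + fourier_coeff g k))\<^sup>2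
      \<le> 2 * (sobolev_weight r k * (cmod (fourier_coeff f k))\<^sup>2)
      + 2 * (sobolev_weight r k * (cmod (fourier_coeff g k))\<^sup>2)"
      by (simp add: algebra_simps)
  qed auto
  then show ?thesis using sobolevD[OF assms(1)] sobolevD[OF assms(2)]
    by (auto simp: sobolev_def fourier_coeff_add intro!: continuous_intros)
qed

lemma sobolev_diff:
  assumes "f \<in> sobolev r" "g \<in> sobolev r"
  shows "(\<lambda>x. f x - g x) \<in> sobolev r"
  using sobolev_add[OF assms(1) sobolev_cmult[OF assms(2), of "-1"]] by simp

lemma sobolev_coeffs_summable:
  assumes "r > 1/2" "f \<in> sobolev r"
  shows "(\<lambda>k. norm (fourier_coeff f k)) summable_on UNIV"
  by (rule weighted_l2_imp_summable[OF assms(1) sobolevD(3)[OF assms(2)]])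

lemma sobolev_fourier_inversion:
  assumes "r > 1/2" "f \<in> sobolev r"
  shows "((\<lambda>k. fourier_coeff f k * circle_char k x) has_sum complex_of_real (f x)) UNIV"
  by (rule fourier_inversion[OF sobolevD(1,2)[OF assms(2)] sobolev_coeffs_summable[OF assms]])

text \<open>The supremum is at most the sum of the moduli of the coefficients, which the weighted
  \<open>l\<^sup>2\<close> norm controls.\<close>

lemma sobolev_sup_bound:
  assumes r: "r > 1/2" and f: "f \<in> sobolev r"
  shows "\<bar>f x\<bar> \<le> embedding_const r * sobolev_norm r f"
proof -
  have "\<bar>f x\<bar> = norm (\<Sum>\<^sub>\<infinity>k. fourier_coeff f k * circle_char k x)"
    unfolding infsumI[OF sobolev_fourier_inversion[OF assms]] norm_of_real ..
  also have "\<dots> \<le> (\<Sum>\<^sub>\<infinity>k. norm (fourier_coeff f k))"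
    using norm_infsum_bound[of "\<lambda>k. fourier_coeff f k * circle_char k x" UNIV] sobolev_coeffs_summable[OF assms]
    by (simp add: norm_mult)
  also have "\<dots> \<le> embedding_const r * sobolev_norm r f"
    unfolding sobolev_norm_def by (rule weighted_l2_imp_bound[OF r sobolevD(3)[OF f]])
  finally show ?thesis .
qed

lemma sobolev_norm_nonneg: "sobolev_norm r f \<ge> 0"
  by (simp add: sobolev_norm_def infsum_nonneg)

section \<open>Derivatives of Sobolev functions\<close>

lemma fourier_coeff_deriv:
  fixes f f' :: "real \<Rightarrow> real"
  assumes der: "\<And>x. (f has_real_derivative f' x) (at x)" and per: "\<And>x. f (x + 1) = f x"
    and f': "continuous_on UNIV f'"
  shows "fourier_coeff f' k = 2 * pi * \<i> * of_int k * fourier_coeff f k"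
proof -
  have f: "continuous_on UNIV f"
    using der DERIV_isCont continuous_at_imp_continuous_on by blast
  have f01: "continuous_on {0..1} f" and f'01: "continuous_on {0..1} f'"
    using f f' continuous_on_subset by blast+
  have vd: "((\<lambda>x. of_real (f x) * circle_char (- k) x) has_vector_derivative
      (of_real (f x) * (2 * pi * \<i> * of_int (- k) * circle_char (- k) x) + of_real (f' x) * circle_char (- k) x)) (at x within {0..1})" for x
  proof (rule has_vector_derivative_mult)
    show "((\<lambda>x. complex_of_real (f x)) has_vector_derivative complex_of_real (f' x)) (at x within {0..1})"
      using der[of x] has_vector_derivative_of_real has_real_derivative_iff_has_vector_derivative
        has_field_derivative_at_within by blast
  qed (rule circle_char_has_vector_derivative)
  have "((\<lambda>x. of_real (f x) * (2 * pi * \<i> * of_int (- k) * circle_char (- k) x) + of_real (f' x) * circle_char (- k) x)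
     has_integral of_real (f 1) * circle_char (- k) 1 - of_real (f 0) * circle_char (- k) 0) {0..1}"
    by (rule fundamental_theorem_of_calculus[OF _ vd]) simp
  moreover have "f 1 = f 0" using per[of 0] by simp
  moreover have "circle_char (- k) 0 = 1" using circle_char_int[of "- k" 0] by simp
  ultimately have "integral {0..1} (\<lambda>x. of_real (f x) * (2 * pi * \<i> * of_int (- k) * circle_char (- k) x) + of_real (f' x) * circle_char (- k) x) = 0"
    by (simp add: integral_unique)
  moreover have "integral {0..1} (\<lambda>x. of_real (f x) * (2 * pi * \<i> * of_int (- k) * circle_char (- k) x) + of_real (f' x) * circle_char (- k) x)
    = integral {0..1} (\<lambda>x. (2 * pi * \<i> * of_int (- k)) * (of_real (f x) * circle_char (- k) x))
      + integral {0..1} (\<lambda>x. of_real (f' x) * circle_char (- k) x)"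
    by (subst integral_add[symmetric])
      (intro integrable_continuous_real continuous_intros f01 f'01 | simp add: mult_ac)+
  ultimately show ?thesis
    by (simp only: integral_mult_right fourier_coeff_eq) (simp add: add_eq_0_iff)
qed

lemma weighted_deriv_coeff_le:
  "sobolev_weight (r - 1) k * (cmod (2 * pi * \<i> * of_int k * c))\<^sup>2
    \<le> (2 * pi)\<^sup>2 * (sobolev_weight r k * (cmod c)\<^sup>2)"
proof -
  have "sobolev_weight (r - 1) k * (cmod (2 * pi * \<i> * of_int k * c))\<^sup>2
     = (2 * pi)\<^sup>2 * (sobolev_weight (r - 1) k * (real_of_int k)\<^sup>2) * (cmod c)\<^sup>2"
    by (simp add: norm_mult power_mult_distrib)
  also have "\<dots> \<le> (2 * pi)\<^sup>2 * (sobolev_weight (r - 1) k * sobolev_weight 1 k) * (cmod c)\<^sup>2"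
    by (intro mult_left_mono mult_right_mono) (auto simp: sobolev_weight_1)
  also have "\<dots> = (2 * pi)\<^sup>2 * (sobolev_weight r k * (cmod c)\<^sup>2)"
    unfolding sobolev_weight_add by (simp add: mult.assoc)
  finally show ?thesis .
qed

text \<open>For \<open>r > 3/2\<close> the formally differentiated series still converges absolutely, to a continuous \<open>g\<close>.
  Integrating it term by term over \<open>[p,q]\<close> gives back \<open>f q - f p\<close>, so \<open>f\<close> is an antiderivative
  of \<open>g\<close>.\<close>

lemma sobolev_classical_derivative:
  assumes r: "r > 3/2" and f: "f \<in> sobolev r"
  obtains g where "continuous_on UNIV g" "\<And>x. g (x + 1) = g x" "\<And>x. (f has_real_derivative g x) (at x)"
proof -
  define b where "b k = 2 * pi * \<i> * of_int k * fourier_coeff f k" for k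
  have "(\<lambda>k. (2 * pi)\<^sup>2 * (sobolev_weight r k * (cmod (fourier_coeff f k))\<^sup>2)) summable_on UNIV"
    by (rule summable_on_cmult_right[OF sobolevD(3)[OF f]])
  then have "(\<lambda>k. sobolev_weight (r - 1) k * (cmod (b k))\<^sup>2) summable_on UNIV"
    unfolding b_def by (rule summable_on_comparison_test) (rule weighted_deriv_coeff_le, simp)
  then have b: "(\<lambda>k. norm (b k)) summable_on UNIV"
    by (rule weighted_l2_imp_summable[rotated]) (use r in simp)
  have sym: "b (- k) = cnj (b k)" for k
    by (simp add: b_def fourier_coeff_cnj)
  obtain g where g: "continuous_on UNIV g" "\<And>x. g (x + 1) = g x"
    "\<And>x. ((\<lambda>k. b k * circle_char k x) has_sum complex_of_real (g x)) UNIV"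
    using real_function_with_coeffs[OF b sym] by metis
  have gpq: "continuous_on {p..q} g" for p q using g(1) continuous_on_subset by blast
  have int: "integral {p..q} g = f q - f p" if "p \<le> q" for p q
  proof -
    have "2 * pi * \<i> * of_int k * integral {p..q} (circle_char k) = circle_char k q - circle_char k p" for k
      using integral_unique[OF fundamental_theorem_of_calculus[OF that circle_char_has_vector_derivative[of k]]]
      by simp
    then have bk: "b k * integral {p..q} (circle_char k) = fourier_coeff f k * circle_char k q - fourier_coeff f k * circle_char k p" for k
      unfolding b_def by (metis mult.assoc mult.commute right_diff_distrib)
    have "((\<lambda>k. b k * integral {p..q} (\<lambda>x. circle_char k x * 1)) has_sum integral {p..q} (\<lambda>x. complex_of_real (g x) * 1)) UNIV"
      by (rule fourier_series_integral[OF b g(3)]) (intro continuous_intros)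
    then have "((\<lambda>k. fourier_coeff f k * circle_char k q - fourier_coeff f k * circle_char k p) has_sum integral {p..q} (\<lambda>x. complex_of_real (g x))) UNIV"
      by (simp add: bk)
    moreover have "((\<lambda>k. fourier_coeff f k * circle_char k q - fourier_coeff f k * circle_char k p) has_sum (of_real (f q) - of_real (f p))) UNIV"
      using has_sum_add[OF sobolev_fourier_inversion[of r f q] has_sum_uminusI[OF sobolev_fourier_inversion[of r f p]]] r f
      by simp
    ultimately have "integral {p..q} (\<lambda>x. complex_of_real (g x)) = of_real (f q - f p)"
      using has_sum_unique by fastforce
    moreover have "integral {p..q} (\<lambda>x. complex_of_real (g x)) = of_real (integral {p..q} g)"
      by (rule integral_linear[OF _ bounded_linear_of_real, unfolded o_def])
        (rule integrable_continuous_real[OF gpq])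
    ultimately show ?thesis using of_real_eq_iff by metis
  qed
  have "(f has_real_derivative g x) (at x)" for x
  proof -
    have "((\<lambda>y. integral {x-1..y} g) has_real_derivative g x) (at x within {x-1..x+1})"
      by (rule integral_has_real_derivative[OF gpq]) simp
    then have "((\<lambda>y. integral {x-1..y} g) has_real_derivative g x) (at x)"
      by (simp add: at_within_Icc_at)
    then have "((\<lambda>y. integral {x-1..y} g + f (x-1)) has_real_derivative g x) (at x)"
      using DERIV_add[OF _ DERIV_const] by fastforce
    then show ?thesis
    proof (rule DERIV_cong_ev[THEN iffD1, OF refl _ refl, rotated])
      show "\<forall>\<^sub>F y in nhds x. integral {x-1..y} g + f (x-1) = f y"
        by (rule eventually_nhds_in_open[of "{x-1<..}" x, THEN eventually_mono]) (auto simp: int)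
    qed
  qed
  with g that show thesis by blast
qed

lemma sobolev_deriv:
  assumes r: "r > 3/2" and f: "f \<in> sobolev r"
  shows sobolev_has_derivative: "(f has_real_derivative deriv f x) (at x)"
    and fourier_coeff_sobolev_deriv: "fourier_coeff (deriv f) k = 2 * pi * \<i> * of_int k * fourier_coeff f k"
    and deriv_in_sobolev: "deriv f \<in> sobolev (r - 1)"
    and sobolev_norm_deriv_le: "sobolev_norm (r - 1) (deriv f) \<le> 2 * pi * sobolev_norm r f"
proof -
  obtain g where g: "continuous_on UNIV g" "\<And>x. g (x + 1) = g x" "\<And>x. (f has_real_derivative g x) (at x)"
    using sobolev_classical_derivative[OF assms] by metis
  have dg: "deriv f = g" using DERIV_imp_deriv[OF g(3)] by blast
  show "(f has_real_derivative deriv f x) (at x)" using g(3) dg by simp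
  have c: "fourier_coeff (deriv f) k = 2 * pi * \<i> * of_int k * fourier_coeff f k" for k
    unfolding dg by (rule fourier_coeff_deriv[OF g(3) sobolevD(2)[OF f] g(1)])
  then show "fourier_coeff (deriv f) k = 2 * pi * \<i> * of_int k * fourier_coeff f k" .
  have sm: "(\<lambda>k. (2 * pi)\<^sup>2 * (sobolev_weight r k * (cmod (fourier_coeff f k))\<^sup>2)) summable_on UNIV"
    by (rule summable_on_cmult_right[OF sobolevD(3)[OF f]])
  then have sm': "(\<lambda>k. sobolev_weight (r - 1) k * (cmod (fourier_coeff (deriv f) k))\<^sup>2) summable_on UNIV"
    unfolding c by (rule summable_on_comparison_test) (rule weighted_deriv_coeff_le, simp)
  then show "deriv f \<in> sobolev (r - 1)"
    using g by (simp add: sobolev_def dg)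
  have "(\<Sum>\<^sub>\<infinity>k. sobolev_weight (r - 1) k * (cmod (fourier_coeff (deriv f) k))\<^sup>2)
      \<le> (\<Sum>\<^sub>\<infinity>k. (2 * pi)\<^sup>2 * (sobolev_weight r k * (cmod (fourier_coeff f k))\<^sup>2))"
    by (rule infsum_mono[OF sm' sm]) (unfold c, rule weighted_deriv_coeff_le)
  also have "\<dots> = (2 * pi)\<^sup>2 * (\<Sum>\<^sub>\<infinity>k. sobolev_weight r k * (cmod (fourier_coeff f k))\<^sup>2)"
    by (rule infsum_cmult_right) (rule sobolevD(3)[OF f])
  finally have "sobolev_norm (r - 1) (deriv f) \<le> sqrt ((2 * pi)\<^sup>2 * (\<Sum>\<^sub>\<infinity>k. sobolev_weight r k * (cmod (fourier_coeff f k))\<^sup>2))"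
    unfolding sobolev_norm_def by (rule real_sqrt_le_mono)
  then show "sobolev_norm (r - 1) (deriv f) \<le> 2 * pi * sobolev_norm r f"
    by (simp add: sobolev_norm_def real_sqrt_mult)
qed

section \<open>Products of Sobolev functions\<close>

text \<open>Young's inequality \<open>l\<^sup>2 * l\<^sup>1 \<subseteq> l\<^sup>2\<close>: Cauchy--Schwarz with the weight \<open>b (k - j)\<close> bounds the square of
  the convolution at \<open>k\<close> by the convolution of \<open>a\<^sup>2\<close> with \<open>b\<close> times the sum of \<open>b\<close>, and a convolution
  of two summable sequences is summable.\<close>

lemma convolution_l2_l1:
  fixes a b :: "int \<Rightarrow> real"
  assumes a0: "\<And>k. a k \<ge> 0" and b0: "\<And>k. b k \<ge> 0"
    and a: "(\<lambda>k. (a k)\<^sup>2) summable_on UNIV" and b: "b summable_on UNIV"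
  shows convolution_summable: "(\<lambda>j. a j * b (k - j)) summable_on UNIV"
    and convolution_l2: "(\<lambda>k. (\<Sum>\<^sub>\<infinity>j. a j * b (k - j))\<^sup>2) summable_on UNIV"
proof -
  have bs: "(\<lambda>j. b (k - j)) summable_on UNIV" "(\<Sum>\<^sub>\<infinity>j. b (k - j)) = (\<Sum>\<^sub>\<infinity>j. b j)" for k
    using b summable_on_reindex_bij_betw[OF bij_diff, of b k] infsum_reindex_bij_betw[OF bij_diff, of b k] by auto
  have bs': "(\<lambda>k. b (k - j)) summable_on UNIV" "(\<Sum>\<^sub>\<infinity>k. b (k - j)) = (\<Sum>\<^sub>\<infinity>j. b j)" for j
    using b summable_on_reindex_bij_betw[OF bij_diff_right[of j], of b] infsum_reindex_bij_betw[OF bij_diff_right[of j], of b] by auto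
  have "(\<lambda>(j, k). (a j)\<^sup>2 * b (k - j)) summable_on UNIV \<times> UNIV"
  proof (rule summable_on_SigmaI)
    show "((\<lambda>k. case (j, k) of (j, k) \<Rightarrow> (a j)\<^sup>2 * b (k - j)) has_sum (a j)\<^sup>2 * (\<Sum>\<^sub>\<infinity>j. b j)) UNIV" for j
      unfolding prod.case using has_sum_cmult_right[OF has_sum_infsum[OF bs'(1)[of j]]] bs'(2)[of j] by metis
    show "(\<lambda>j. (a j)\<^sup>2 * (\<Sum>\<^sub>\<infinity>j. b j)) summable_on UNIV"
      by (rule summable_on_cmult_left[OF a])
  qed (simp add: b0)
  then have 2: "(\<lambda>(k, j). (a j)\<^sup>2 * b (k - j)) summable_on UNIV \<times> UNIV"
    by (subst (asm) summable_on_swap) (simp add: case_prod_unfold)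
  define Q where "Q k = (\<Sum>\<^sub>\<infinity>j. (a j)\<^sup>2 * b (k - j))" for k
  have q: "(\<lambda>j. (a j)\<^sup>2 * b (k - j)) summable_on UNIV" for k
    using summable_on_SigmaD1[OF 2] by simp
  have Q: "Q summable_on UNIV"
    unfolding Q_def using summable_on_Sigma_banach[OF 2] by simp
  show conv: "(\<lambda>j. a j * b (k - j)) summable_on UNIV" for k
  proof (rule summable_on_comparison_test)
    show "(\<lambda>j. b (k - j) + (a j)\<^sup>2 * b (k - j)) summable_on UNIV"
      by (intro summable_on_add bs q)
    fix j
    have "a j \<le> 1 + (a j)\<^sup>2" using sum_squares_bound[of "a j" 1] a0[of j] by simp
    then show "a j * b (k - j) \<le> b (k - j) + (a j)\<^sup>2 * b (k - j)"
      using mult_right_mono[of "a j" "1 + (a j)\<^sup>2" "b (k - j)"] b0 by (simp add: distrib_right)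
  qed (simp add: a0 b0)
  show "(\<lambda>k. (\<Sum>\<^sub>\<infinity>j. a j * b (k - j))\<^sup>2) summable_on UNIV"
  proof (rule summable_on_comparison_test)
    show "(\<lambda>k. Q k * (\<Sum>\<^sub>\<infinity>j. b j)) summable_on UNIV" by (rule summable_on_cmult_left[OF Q])
    fix k
    have "(\<Sum>\<^sub>\<infinity>j. a j * b (k - j)) \<le> sqrt (Q k * (\<Sum>\<^sub>\<infinity>j. b j))"
    proof (rule infsum_le_finite_sums[OF conv])
      fix F :: "int set" assume F: "finite F"
      have "(\<Sum>j\<in>F. a j * b (k - j))\<^sup>2 = (\<Sum>j\<in>F. (a j * sqrt (b (k - j))) * sqrt (b (k - j)))\<^sup>2"
        using b0 by (simp add: mult.assoc)
      also have "\<dots> \<le> (\<Sum>j\<in>F. (a j * sqrt (b (k - j)))\<^sup>2) * (\<Sum>j\<in>F. (sqrt (b (k - j)))\<^sup>2)"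
        by (rule Cauchy_Schwarz_ineq_sum)
      also have "\<dots> = (\<Sum>j\<in>F. (a j)\<^sup>2 * b (k - j)) * (\<Sum>j\<in>F. b (k - j))"
        using b0 by (simp add: power_mult_distrib)
      also have "\<dots> \<le> Q k * (\<Sum>\<^sub>\<infinity>j. b (k - j))"
        unfolding Q_def by (intro mult_mono finite_sum_le_infsum q bs F sum_nonneg infsum_nonneg) (auto simp: b0)
      finally show "(\<Sum>j\<in>F. a j * b (k - j)) \<le> sqrt (Q k * (\<Sum>\<^sub>\<infinity>j. b j))"
        unfolding bs(2) by (rule real_le_rsqrt)
    qed
    then have "(\<Sum>\<^sub>\<infinity>j. a j * b (k - j))\<^sup>2 \<le> (sqrt (Q k * (\<Sum>\<^sub>\<infinity>j. b j)))\<^sup>2"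
      by (rule power_mono) (simp add: infsum_nonneg a0 b0)
    also have "\<dots> = Q k * (\<Sum>\<^sub>\<infinity>j. b j)"
      by (rule real_sqrt_pow2) (simp add: Q_def infsum_nonneg b0)
    finally show "(\<Sum>\<^sub>\<infinity>j. a j * b (k - j))\<^sup>2 \<le> Q k * (\<Sum>\<^sub>\<infinity>j. b j)" .
  qed simp
qed

lemma fourier_coeff_mult:
  assumes r: "r > 1/2" and f: "f \<in> sobolev r" and g: "continuous_on UNIV g"
  shows "((\<lambda>j. fourier_coeff f j * fourier_coeff g (k - j)) has_sum fourier_coeff (\<lambda>x. f x * g x) k) UNIV"
proof -
  have g01: "continuous_on {0..1} g" using g continuous_on_subset by blast
  have "((\<lambda>j. fourier_coeff f j * integral {0..1} (\<lambda>x. circle_char j x * (of_real (g x) * circle_char (- k) x)))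
      has_sum integral {0..1} (\<lambda>x. of_real (f x) * (of_real (g x) * circle_char (- k) x))) UNIV"
    by (rule fourier_series_integral[OF sobolev_coeffs_summable[OF r f] sobolev_fourier_inversion[OF r f]])
      (intro continuous_intros g01)
  moreover have "circle_char j x * (of_real (g x) * circle_char (- k) x) = of_real (g x) * circle_char (- (k - j)) x" for j x
    by (simp add: circle_char_mult mult.left_commute)
  ultimately show ?thesis by (simp add: fourier_coeff_eq mult.assoc)
qed

text \<open>From \<open>k = j + (k - j)\<close> the larger of the two frequencies is at least \<open>\<bar>k\<bar> / 2\<close>. This splits the
  weight of a product between its factors.\<close>

lemma sobolev_weight_subadditive:
  assumes "r \<ge> 0"
  shows "sobolev_weight r k \<le> 4 powr r * (sobolev_weight r j + sobolev_weight r (k - j))"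
proof -
  define m where "m = max (1 + (real_of_int j)\<^sup>2) (1 + (real_of_int (k - j))\<^sup>2)"
  have m: "m > 0" unfolding m_def by (smt (verit) zero_le_power2)
  have "(real_of_int k)\<^sup>2 \<le> 2 * (real_of_int j)\<^sup>2 + 2 * (real_of_int (k - j))\<^sup>2"
    using sum_squares_bound[of "real_of_int j" "real_of_int (k - j)"] power2_sum[of "real_of_int j" "real_of_int (k - j)"] by simp
  then have "1 + (real_of_int k)\<^sup>2 \<le> 4 * m" unfolding m_def by (smt (verit))
  then have "sobolev_weight r k \<le> (4 * m) powr r"
    unfolding sobolev_weight_def using assms by (intro powr_mono2) auto
  also have "\<dots> = 4 powr r * m powr r" using m by (intro powr_mult) 
  also have "m powr r \<le> sobolev_weight r j + sobolev_weight r (k - j)"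
    unfolding m_def max_def sobolev_weight_def by auto
  finally show ?thesis by (simp add: mult_left_mono)
qed

text \<open>The weight of frequency \<open>k\<close> is moved onto one of the two factors, and the other factor is left
  with coefficients in \<open>l\<^sup>1\<close> because \<open>r > 1/2\<close>; each of the two resulting convolutions
  \<open>P\<close>, \<open>Q\<close> is in \<open>l\<^sup>2\<close> by Young's inequality.\<close>

lemma sobolev_mult:
  assumes r: "r > 1/2" and f: "f \<in> sobolev r" and g: "g \<in> sobolev r"
  shows "(\<lambda>x. f x * g x) \<in> sobolev r"
proof -
  define a where "a k = norm (fourier_coeff f k)" for k
  define b where "b k = norm (fourier_coeff g k)" for k
  define w where "w = sobolev_weight (r / 2)"
  have w2: "(w k * x)\<^sup>2 = sobolev_weight r k * x\<^sup>2" for k x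
    by (simp add: w_def power_mult_distrib power2_eq_square[of "sobolev_weight _ _"] sobolev_weight_add)
  have a: "a summable_on UNIV" and b: "b summable_on UNIV"
    unfolding a_def b_def using sobolev_coeffs_summable r f g by auto
  have A: "(\<lambda>k. (w k * a k)\<^sup>2) summable_on UNIV" and B: "(\<lambda>k. (w k * b k)\<^sup>2) summable_on UNIV"
    unfolding w2 a_def b_def by (rule sobolevD(3), fact)+
  have nn: "w k * a k \<ge> 0" "w k * b k \<ge> 0" "a k \<ge> 0" "b k \<ge> 0" for k
    by (auto simp: w_def a_def b_def)
  define P where "P k = (\<Sum>\<^sub>\<infinity>j. (w j * a j) * b (k - j))" for k
  define Q where "Q k = (\<Sum>\<^sub>\<infinity>j. (w j * b j) * a (k - j))" for k
  note cP = convolution_l2_l1[of "\<lambda>k. w k * a k" b, OF nn(1) nn(4) A b, folded P_def]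
  note cQ = convolution_l2_l1[of "\<lambda>k. w k * b k" a, OF nn(2) nn(3) B a, folded Q_def]
  have Q': "(\<lambda>j. (w (k - j) * b (k - j)) * a j) summable_on UNIV" "(\<Sum>\<^sub>\<infinity>j. (w (k - j) * b (k - j)) * a j) = Q k" for k
    using cQ(1)[of k] summable_on_reindex_bij_betw[OF bij_diff, of "\<lambda>j. (w j * b j) * a (k - j)" k]
      infsum_reindex_bij_betw[OF bij_diff, of "\<lambda>j. (w j * b j) * a (k - j)" k] by (auto simp: Q_def)
  let ?C = "4 powr (r / 2)"
  have bound: "w k * norm (fourier_coeff (\<lambda>x. f x * g x) k) \<le> ?C * (P k + Q k)" for k
  proof -
    have sm: "(\<lambda>j. ?C * ((w j * a j) * b (k - j) + (w (k - j) * b (k - j)) * a j)) summable_on UNIV"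
      by (intro summable_on_cmult_right summable_on_add cP(1) Q'(1))
    have "((\<lambda>j. w k * (fourier_coeff f j * fourier_coeff g (k - j))) has_sum w k * fourier_coeff (\<lambda>x. f x * g x) k) UNIV"
      by (rule has_sum_cmult_right[OF fourier_coeff_mult[OF r f sobolevD(1)[OF g]]])
    then have "norm (w k * fourier_coeff (\<lambda>x. f x * g x) k) \<le> (\<Sum>\<^sub>\<infinity>j. ?C * ((w j * a j) * b (k - j) + (w (k - j) * b (k - j)) * a j))"
    proof (rule norm_infsum_le[OF _ has_sum_infsum[OF sm]])
      fix j
      have "w k * (a j * b (k - j)) \<le> (?C * (w j + w (k - j))) * (a j * b (k - j))"
        unfolding w_def using r nn by (intro mult_right_mono sobolev_weight_subadditive) auto
      then show "norm (w k * (fourier_coeff f j * fourier_coeff g (k - j))) \<le> ?C * ((w j * a j) * b (k - j) + (w (k - j) * b (k - j)) * a j)"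
        by (simp add: norm_mult a_def b_def w_def algebra_simps)
    qed
    also have "\<dots> = ?C * (P k + Q k)"
      using infsum_add[OF cP(1)[of k] Q'(1)[of k]] Q'(2)[of k]
      by (simp add: infsum_cmult_right' P_def)
    finally show ?thesis by (simp add: norm_mult w_def)
  qed
  have "(\<lambda>k. ?C\<^sup>2 * (2 * (P k)\<^sup>2 + 2 * (Q k)\<^sup>2)) summable_on UNIV"
    by (intro summable_on_cmult_right summable_on_add cP(2) cQ(2))
  then have "(\<lambda>k. (w k * norm (fourier_coeff (\<lambda>x. f x * g x) k))\<^sup>2) summable_on UNIV"
  proof (rule summable_on_comparison_test)
    fix k
    have "(w k * norm (fourier_coeff (\<lambda>x. f x * g x) k))\<^sup>2 \<le> (?C * (P k + Q k))\<^sup>2"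
      using bound by (rule power_mono) (simp add: w_def)
    also have "\<dots> = ?C\<^sup>2 * (P k + Q k)\<^sup>2" by (rule power_mult_distrib)
    also have "\<dots> \<le> ?C\<^sup>2 * (2 * (P k)\<^sup>2 + 2 * (Q k)\<^sup>2)"
      using sum_squares_bound[of "P k" "Q k"] by (intro mult_left_mono) (auto simp: power2_sum)
    finally show "(w k * norm (fourier_coeff (\<lambda>x. f x * g x) k))\<^sup>2 \<le> ?C\<^sup>2 * (2 * (P k)\<^sup>2 + 2 * (Q k)\<^sup>2)" .
  qed simp
  then show ?thesis
    unfolding w2 using sobolevD(1,2)[OF f] sobolevD(1,2)[OF g]
    by (auto simp: sobolev_def intro!: continuous_intros)
qed

section \<open>The operator A and the right-hand side of the equation\<close>

lemma fourier_coeff_0: 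
  assumes "continuous_on UNIV f"
  shows "fourier_coeff f 0 = of_real (mean f)"
proof -
  have "integral {0..1} (\<lambda>x. complex_of_real (f x)) = of_real (integral {0..1} f)"
    by (rule integral_linear[OF _ bounded_linear_of_real, unfolded o_def])
      (intro integrable_continuous_real continuous_on_subset[OF assms], simp)
  then show ?thesis by (simp add: fourier_coeff_eq mean_def)
qed

lemma fourier_coeff_mu_op:
  assumes r: "r > 1/2" and h: "h \<in> sobolev (r + 2)"
  shows "fourier_coeff (mu_op h) k = (if k = 0 then fourier_coeff h 0 else (2 * pi * k)\<^sup>2 * fourier_coeff h k)"
    and mu_op_continuous: "continuous_on UNIV (mu_op h)"
    and mu_op_periodic: "mu_op h (x + 1) = mu_op h x"
proof -
  have h1: "deriv h \<in> sobolev (r + 1)" and h2: "deriv (deriv h) \<in> sobolev r"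
    using deriv_in_sobolev[of "r + 2" h] deriv_in_sobolev[of "r + 1" "deriv h"] r h by (auto simp: add_ac)
  have c: "fourier_coeff (deriv (deriv h)) k = - ((2 * pi * k)\<^sup>2 * fourier_coeff h k)" for k
    using fourier_coeff_sobolev_deriv[of "r + 2" h k] fourier_coeff_sobolev_deriv[of "r + 1" "deriv h" k] r h h1
    by (simp add: power2_eq_square)
  show "fourier_coeff (mu_op h) k = (if k = 0 then fourier_coeff h 0 else (2 * pi * k)\<^sup>2 * fourier_coeff h k)"
    unfolding mu_op_def
    by (subst fourier_coeff_diff)
      (auto simp: fourier_coeff_const c fourier_coeff_0 sobolevD[OF h] sobolevD[OF h2])
  show "continuous_on UNIV (mu_op h)" "mu_op h (x + 1) = mu_op h x"
    unfolding mu_op_def using sobolevD[OF h2] by (auto intro!: continuous_intros)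
qed

text \<open>On frequencies, \<open>mu_op\<close> multiplies by \<open>1\<close> for \<open>k = 0\<close> and by \<open>(2 \<pi> k)\<^sup>2\<close> otherwise. Dividing the
  coefficients of \<open>g\<close> by these numbers gains two orders of regularity. Without surjectivity the
  function \<open>mu_op_inv\<close>, an \<open>inv_into\<close>, would carry no information at \<open>g\<close>.\<close>

lemma mu_op_surj:
  assumes r: "r > 1/2" and g: "g \<in> sobolev r"
  obtains h where "h \<in> sobolev (r + 2)" "mu_op h = g"
proof -
  define d where "d k = (if k = 0 then fourier_coeff g 0 else fourier_coeff g k / (2 * pi * k)\<^sup>2)" for k
  have dle: "cmod (d k) * sobolev_weight 1 k \<le> cmod (fourier_coeff g k)" for k
  proof (cases "k = 0")
    case False
    have "1 \<le> k\<^sup>2" using False by (simp add: int_one_le_iff_zero_less)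
    then have "1 \<le> (real_of_int k)\<^sup>2" by (metis of_int_1_le_iff of_int_power)
    moreover have "1 \<le> pi\<^sup>2" using pi_gt3 by (simp add: power2_eq_square mult_ge1_I)
    ultimately have "1 + (real_of_int k)\<^sup>2 \<le> (2 * pi * k)\<^sup>2"
      using mult_mono[of 1 "pi\<^sup>2" "(real_of_int k)\<^sup>2" "(real_of_int k)\<^sup>2"] by (simp add: power_mult_distrib)
    then have "(1 + (real_of_int k)\<^sup>2) / (2 * pi * k)\<^sup>2 * cmod (fourier_coeff g k) \<le> 1 * cmod (fourier_coeff g k)"
      using False by (intro mult_right_mono) (auto simp: divide_le_eq_1)
    then show ?thesis using False
      by (simp add: d_def sobolev_weight_1 norm_divide norm_mult norm_power power_mult_distrib mult_ac)
  qed (simp add: d_def sobolev_weight_1)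
  have "(\<lambda>k. sobolev_weight (r + 2) k * (cmod (d k))\<^sup>2) summable_on UNIV"
  proof (rule summable_on_comparison_test[OF sobolevD(3)[OF g]])
    fix k
    have "sobolev_weight (r + 2) k * (cmod (d k))\<^sup>2 = sobolev_weight r k * (cmod (d k) * sobolev_weight 1 k)\<^sup>2"
      by (simp add: power_mult_distrib power2_eq_square[of "sobolev_weight _ _"] sobolev_weight_add mult_ac)
    also have "\<dots> \<le> sobolev_weight r k * (cmod (fourier_coeff g k))\<^sup>2"
      by (intro mult_left_mono power_mono dle) auto
    finally show "sobolev_weight (r + 2) k * (cmod (d k))\<^sup>2 \<le> sobolev_weight r k * (cmod (fourier_coeff g k))\<^sup>2" .
  qed auto
  note dsum = this
  have "(\<lambda>k. norm (d k)) summable_on UNIV"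
    by (rule weighted_l2_imp_summable[OF _ dsum]) (use r in simp)
  moreover have "d (- k) = cnj (d k)" for k
    by (simp add: d_def fourier_coeff_cnj) (use fourier_coeff_cnj[of g 0] in simp)
  ultimately obtain h where h: "continuous_on UNIV h" "\<And>x. h (x + 1) = h x" "\<And>k. fourier_coeff h k = d k"
    using real_function_with_coeffs by metis
  then have hs: "h \<in> sobolev (r + 2)" using dsum by (simp add: sobolev_def)
  have "mu_op h = g"
  proof (rule fourier_coeff_eq_imp_eq)
    show "fourier_coeff (mu_op h) k = fourier_coeff g k" for k
      by (simp add: fourier_coeff_mu_op[OF r hs] h d_def)
  qed (use mu_op_continuous[OF r hs] mu_op_periodic[OF r hs] sobolevD[OF g] in auto)
  with hs that show thesis by blast
qed

lemma mean_mu_op: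
  assumes "r > 1/2" "h \<in> sobolev (r + 2)"
  shows "mean (mu_op h) = mean h"
proof -
  have "complex_of_real (mean (mu_op h)) = of_real (mean h)"
    using fourier_coeff_mu_op(1)[OF assms, of 0] fourier_coeff_0[OF mu_op_continuous[OF assms]]
      fourier_coeff_0[OF sobolevD(1)[OF assms(2)]] by simp
  then show ?thesis by simp
qed

text \<open>If \<open>h\<close> is the preimage of \<open>g\<close> under \<open>mu_op\<close>, then \<open>- h'' = g - mean h\<close> and \<open>mean h = mean g\<close>, so
  differentiating \<open>- h' - lam * w\<close> leaves a local expression up to the mean of \<open>g\<close>. The product
  theorem enters because \<open>g\<close> must lie in \<open>H^(s-1)\<close> to have a preimage.\<close>

lemma muHS_rhs_has_derivative:
  fixes lam m t :: real and w :: "real \<Rightarrow> real"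
  assumes s: "s > 3/2" and w: "w \<in> sobolev s"
  defines "g \<equiv> \<lambda>z. 2 * m * exp (- lam * t) * w z + 1 / 2 * (deriv w z)\<^sup>2"
  shows "(muHS_rhs s lam m t w has_real_derivative g x - mean g - lam * deriv w x) (at x)"
proof -
  have s1: "s - 1 > 1/2" using s by simp
  have w': "deriv w \<in> sobolev (s - 1)" by (rule deriv_in_sobolev[OF s w])
  have g: "g \<in> sobolev (s - 1)"
    unfolding g_def power2_eq_square
    by (intro sobolev_add sobolev_cmult sobolev_mult s1 w' sobolev_mono[OF _ w]) simp
  define h where "h = mu_op_inv (s - 1) g"
  have "g \<in> mu_op ` sobolev (s - 1 + 2)" using mu_op_surj[OF s1 g] by (metis image_eqI)
  then have h: "h \<in> sobolev (s - 1 + 2)" and hg: "mu_op h = g"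
    unfolding h_def mu_op_inv_def by (rule inv_into_into, rule f_inv_into_f)
  have h1: "deriv h \<in> sobolev (s - 1 + 1)"
    using deriv_in_sobolev[OF _ h] s by (simp add: algebra_simps)
  have "(deriv h has_real_derivative deriv (deriv h) x) (at x)"
    by (rule sobolev_has_derivative[OF _ h1]) (use s in simp)
  moreover have "deriv (deriv h) x = mean g - g x"
  proof -
    have "mean h - deriv (deriv h) x = g x" using fun_cong[OF hg, of x] by (simp only: mu_op_def)
    moreover have "mean g = mean h" using mean_mu_op[OF s1 h] by (simp only: hg)
    ultimately show ?thesis by simp
  qed
  moreover have "(w has_real_derivative deriv w x) (at x)" by (rule sobolev_has_derivative[OF s w])
  ultimately have "((\<lambda>x. - deriv h x - lam * w x) has_real_derivative g x - mean g - lam * deriv w x) (at x)"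
    by (auto intro!: derivative_eq_intros)
  then show ?thesis unfolding muHS_rhs_def h_def g_def by simp
qed

section \<open>From Sobolev norms in time to pointwise statements\<close>

lemma sobolev_continuous_on_imp_continuous:
  assumes r: "r > 1/2" and u: "sobolev_continuous_on r I u"
  shows "continuous_on (I \<times> UNIV) (\<lambda>(t, x). u t x)"
  unfolding continuous_on_iff
proof safe
  fix t0 x0 and e :: real
  assume t0: "t0 \<in> I" and e: "e > 0"
  let ?C = "\<bar>embedding_const r\<bar> + 1"
  have "((\<lambda>\<tau>. sobolev_norm r (\<lambda>x. u \<tau> x - u t0 x)) \<longlongrightarrow> 0) (at t0 within I)"
    using u t0 by (simp add: sobolev_continuous_on_def)
  then have "\<forall>\<^sub>F \<tau> in at t0 within I. sobolev_norm r (\<lambda>x. u \<tau> x - u t0 x) < e / (2 * ?C)"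
    by (rule order_tendstoD) (use e in simp)
  then obtain d1 where d1: "d1 > 0" "\<And>\<tau>. \<tau> \<in> I \<Longrightarrow> \<tau> \<noteq> t0 \<Longrightarrow> dist \<tau> t0 < d1 \<Longrightarrow> sobolev_norm r (\<lambda>x. u \<tau> x - u t0 x) < e / (2 * ?C)"
    unfolding eventually_at by auto
  have sob: "u \<tau> \<in> sobolev r" if "\<tau> \<in> I" for \<tau>
    using u that by (simp add: sobolev_continuous_on_def)
  obtain d2 where d2: "d2 > 0" "\<And>x. dist x x0 < d2 \<Longrightarrow> dist (u t0 x) (u t0 x0) < e / 2"
    using sobolevD(1)[OF sob[OF t0]] e unfolding continuous_on_iff by (metis UNIV_I half_gt_zero)
  show "\<exists>d>0. \<forall>p\<in>I \<times> UNIV. dist p (t0, x0) < d \<longrightarrow> dist (case p of (t, x) \<Rightarrow> u t x) (u t0 x0) < e"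
  proof (intro exI conjI ballI impI)
    show "min d1 d2 > 0" using d1 d2 by simp
    fix p assume p: "p \<in> I \<times> UNIV" "dist p (t0, x0) < min d1 d2"
    obtain t x where tx: "p = (t, x)" by (cases p)
    have dt: "dist t t0 < d1" "dist x x0 < d2" and t: "t \<in> I"
      using p dist_fst_le[of p "(t0, x0)"] dist_snd_le[of p "(t0, x0)"] by (auto simp: tx)
    have "\<bar>u t x - u t0 x\<bar> < e / 2"
    proof (cases "t = t0")
      case False
      have "\<bar>u t x - u t0 x\<bar> \<le> embedding_const r * sobolev_norm r (\<lambda>x. u t x - u t0 x)"
        by (rule sobolev_sup_bound[OF r sobolev_diff]) (use sob t t0 in auto)
      also have "\<dots> \<le> ?C * sobolev_norm r (\<lambda>x. u t x - u t0 x)"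
        by (rule mult_right_mono) (auto simp: sobolev_norm_nonneg)
      also have "\<dots> < ?C * (e / (2 * ?C))"
        using d1(2)[OF t False dt(1)] by (intro mult_strict_left_mono) auto
      also have "\<dots> = e / 2" by (simp add: field_simps add_nonneg_eq_0_iff)
      finally show ?thesis .
    qed (use e in simp)
    moreover have "\<bar>u t0 x - u t0 x0\<bar> < e / 2"
      using d2(2)[OF dt(2)] by (simp add: dist_real_def)
    ultimately show "dist (case p of (t, x) \<Rightarrow> u t x) (u t0 x0) < e"
      unfolding tx dist_real_def prod.case by linarith
  qed
qed

lemma sobolev_continuous_on_deriv:
  assumes r: "r > 3/2" and u: "sobolev_continuous_on r I u"
  shows "sobolev_continuous_on (r - 1) I (\<lambda>t. deriv (u t))"
  unfolding sobolev_continuous_on_def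
proof safe
  fix t assume t: "t \<in> I"
  have sob: "u \<tau> \<in> sobolev r" if "\<tau> \<in> I" for \<tau>
    using u that by (simp add: sobolev_continuous_on_def)
  show "deriv (u t) \<in> sobolev (r - 1)" by (rule deriv_in_sobolev[OF r sob[OF t]])
  have le: "sobolev_norm (r - 1) (\<lambda>x. deriv (u \<tau>) x - deriv (u t) x) \<le> 2 * pi * sobolev_norm r (\<lambda>x. u \<tau> x - u t x)"
    if "\<tau> \<in> I" for \<tau>
  proof -
    have "deriv (\<lambda>x. u \<tau> x - u t x) = (\<lambda>x. deriv (u \<tau>) x - deriv (u t) x)"
      by (intro ext DERIV_imp_deriv DERIV_diff sobolev_has_derivative[OF r] sob t that)
    with sobolev_norm_deriv_le[OF r sobolev_diff[OF sob[OF that] sob[OF t]]] show ?thesis by simp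
  qed
  have "((\<lambda>\<tau>. 2 * pi * sobolev_norm r (\<lambda>x. u \<tau> x - u t x)) \<longlongrightarrow> 2 * pi * 0) (at t within I)"
    using u t by (intro tendsto_mult_left) (simp add: sobolev_continuous_on_def)
  then have lim: "((\<lambda>\<tau>. 2 * pi * sobolev_norm r (\<lambda>x. u \<tau> x - u t x)) \<longlongrightarrow> 0) (at t within I)"
    by simp
  show "((\<lambda>\<tau>. sobolev_norm (r - 1) (\<lambda>x. deriv (u \<tau>) x - deriv (u t) x)) \<longlongrightarrow> 0) (at t within I)"
    by (rule tendsto_sandwich[OF _ _ tendsto_const lim])
      (auto simp: eventually_at_filter sobolev_norm_nonneg le)
qed

text \<open>Convergence of the difference quotients in \<open>H^r\<close>, \<open>r > 1/2\<close>, is in particular uniform in \<open>x\<close>.\<close>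

lemma sobolev_C1_on_has_derivative:
  assumes r: "r > 1/2" and u: "sobolev_C1_on r I u v" and t: "t \<in> I"
  shows "((\<lambda>\<tau>. u \<tau> x) has_real_derivative v t x) (at t within I)"
  unfolding has_field_derivative_iff
proof (rule LIM_zero_cancel)
  have sob: "u \<tau> \<in> sobolev r" "v \<tau> \<in> sobolev r" if "\<tau> \<in> I" for \<tau>
    using u that by (auto simp: sobolev_C1_on_def sobolev_continuous_on_def)
  have "((\<lambda>\<tau>. embedding_const r * sobolev_norm r (\<lambda>x. (u \<tau> x - u t x) / (\<tau> - t) - v t x)) \<longlongrightarrow> embedding_const r * 0) (at t within I)"
    using u t by (intro tendsto_mult_left) (simp add: sobolev_C1_on_def)
  then have lim: "((\<lambda>\<tau>. embedding_const r * sobolev_norm r (\<lambda>x. (u \<tau> x - u t x) / (\<tau> - t) - v t x)) \<longlongrightarrow> 0) (at t within I)"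
    by simp
  have "(\<lambda>x. (u \<tau> x - u t x) / (\<tau> - t) - v t x) \<in> sobolev r" if "\<tau> \<in> I" for \<tau>
    using sobolev_diff[OF sobolev_cmult[OF sobolev_diff[OF sob(1)[OF that] sob(1)[OF t]], of "1 / (\<tau> - t)"] sob(2)[OF t]]
    by simp
  from sobolev_sup_bound[OF r this]
  have "\<forall>\<^sub>F \<tau> in at t within I. norm ((u \<tau> x - u t x) / (\<tau> - t) - v t x)
    \<le> embedding_const r * sobolev_norm r (\<lambda>x. (u \<tau> x - u t x) / (\<tau> - t) - v t x)"
    by (simp add: eventually_at_filter)
  then show "((\<lambda>\<tau>. (u \<tau> x - u t x) / (\<tau> - t) - v t x) \<longlongrightarrow> 0) (at t within I)"
    by (rule Lim_null_comparison[OF _ lim])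
qed

text \<open>Two values of \<open>f\<close> in one period differ by at most the integral of \<open>\<bar>f'\<bar>\<close> over the period;
  averaging over one of the two points gives the claim.\<close>

lemma periodic_deviation_from_mean:
  fixes f f' :: "real \<Rightarrow> real"
  assumes der: "\<And>x. (f has_real_derivative f' x) (at x)" and per: "\<And>x. f (x + 1) = f x"
    and f': "continuous_on UNIV f'"
  shows "\<bar>f x - mean f\<bar> \<le> integral {0..1} (\<lambda>x. \<bar>f' x\<bar>)"
proof -
  let ?D = "integral {0..1} (\<lambda>x. \<bar>f' x\<bar>)"
  have f'c: "continuous_on {p..q} f'" for p q using f' continuous_on_subset by blast
  have fc: "continuous_on {p..q} f" for p q
    using der DERIV_isCont continuous_at_imp_continuous_on by blast
  have le: "\<bar>f q - f p\<bar> \<le> ?D" if "0 \<le> p" "p \<le> q" "q \<le> 1" for p q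
  proof -
    have "(f' has_integral (f q - f p)) {p..q}"
      using der that by (intro fundamental_theorem_of_calculus)
        (auto simp: has_real_derivative_iff_has_vector_derivative[symmetric] intro: has_field_derivative_at_within)
    then have "\<bar>f q - f p\<bar> = norm (integral {p..q} f')" by (simp add: integral_unique)
    also have "\<dots> \<le> integral {p..q} (\<lambda>x. \<bar>f' x\<bar>)"
      by (rule integral_norm_bound_integral) (auto intro!: integrable_continuous_real continuous_intros f'c)
    also have "\<dots> \<le> ?D"
      using that by (intro integral_subset_le integrable_continuous_real continuous_intros f'c) auto
    finally show ?thesis .
  qed
  define y where "y = frac x"
  have y: "0 \<le> y" "y \<le> 1" unfolding y_def using frac_lt_1[of x] by auto
  have fy: "f x = f y" unfolding y_def using periodic_frac[of f x] per by simp
  have close: "\<bar>f y - f z\<bar> \<le> ?D" if "z \<in> {0..1}" for z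
    using le[of y z] le[of z y] y that by (cases "y \<le> z") auto
  have close': "f z \<le> f y + ?D" "f y - ?D \<le> f z" if "z \<in> {0..1}" for z
    using close[OF that] by linarith+
  have "mean f \<le> integral {0..1} (\<lambda>z::real. f y + ?D)"
    unfolding mean_def by (rule integral_le) (auto intro!: integrable_continuous_real fc close')
  moreover have "integral {0..1} (\<lambda>z::real. f y - ?D) \<le> mean f"
    unfolding mean_def by (rule integral_le) (auto intro!: integrable_continuous_real fc close')
  ultimately show ?thesis unfolding fy by simp
qed

text \<open>The mean of \<open>g\<close> contains half the integral of \<open>w'\<^sup>2\<close>, and this term absorbs the linear one:
  \<open>2 * \<bar>m\<bar> * \<bar>w x - mean w\<bar>\<close> is at most the integral of \<open>2 * \<bar>m\<bar> * \<bar>w'\<bar> \<le> w'\<^sup>2 / 2 + 2 * m\<^sup>2\<close>.\<close>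

lemma muHS_source_bound:
  fixes lam m t :: real and w :: "real \<Rightarrow> real"
  assumes s: "s > 3/2" and w: "w \<in> sobolev s" and lam: "lam \<ge> 0" "t \<ge> 0"
  defines "g \<equiv> \<lambda>z. 2 * m * exp (- lam * t) * w z + 1 / 2 * (deriv w z)\<^sup>2"
  shows "g x - mean g \<le> (deriv w x)\<^sup>2 / 2 + 2 * m\<^sup>2"
proof -
  define c where "c = 2 * m * exp (- lam * t)"
  note der = sobolev_has_derivative[OF s w]
  have w': "continuous_on UNIV (deriv w)" using sobolevD(1)[OF deriv_in_sobolev[OF s w]] .
  then have w'01: "continuous_on {0..1} (deriv w)" using continuous_on_subset by blast
  have w01: "continuous_on {0..1} w" using sobolevD(1)[OF w] continuous_on_subset by blast
  have mg: "mean g = c * mean w + integral {0..1} (\<lambda>z. (deriv w z)\<^sup>2) / 2"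
    unfolding mean_def g_def c_def[symmetric]
    by (subst integral_add) (auto intro!: integrable_continuous_real continuous_intros w01 w'01)
  let ?D = "integral {0..1} (\<lambda>x. \<bar>deriv w x\<bar>)"
  have D: "\<bar>w x - mean w\<bar> \<le> ?D" by (rule periodic_deviation_from_mean[OF der sobolevD(2)[OF w] w'])
  have c: "\<bar>c\<bar> \<le> 2 * \<bar>m\<bar>" using lam by (simp add: c_def abs_mult mult_left_le)
  have "c * (w x - mean w) \<le> \<bar>c\<bar> * \<bar>w x - mean w\<bar>" by (metis abs_ge_self abs_mult)
  also have "\<dots> \<le> 2 * \<bar>m\<bar> * ?D" by (intro mult_mono c D) auto
  also have "\<dots> = integral {0..1} (\<lambda>x. 2 * \<bar>m\<bar> * \<bar>deriv w x\<bar>)" by simp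
  also have "\<dots> \<le> integral {0..1} (\<lambda>x. (deriv w x)\<^sup>2 / 2 + 2 * m\<^sup>2)"
  proof (intro integral_le integrable_continuous_real continuous_intros w'01)
    fix x
    show "2 * \<bar>m\<bar> * \<bar>deriv w x\<bar> \<le> (deriv w x)\<^sup>2 / 2 + 2 * m\<^sup>2"
      using sum_squares_bound[of "2 * \<bar>m\<bar>" "\<bar>deriv w x\<bar>"] by (simp add: power_mult_distrib)
  qed auto
  also have "\<dots> = integral {0..1} (\<lambda>z. (deriv w z)\<^sup>2) / 2 + 2 * m\<^sup>2"
    by (subst integral_add) (auto intro!: integrable_continuous_real continuous_intros w'01)
  finally have "c * w x + (deriv w x)\<^sup>2 / 2 - mean g \<le> (deriv w x)\<^sup>2 / 2 + 2 * m\<^sup>2"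
    unfolding mg by (simp add: right_diff_distrib)
  moreover have "g x = c * w x + (deriv w x)\<^sup>2 / 2" by (simp add: g_def c_def)
  ultimately show ?thesis by simp
qed

section \<open>Blow-up of the slope\<close>

text \<open>The bound on \<open>m\<close> puts it to the left of the smaller root of the quadratic polynomial. After
  division by \<open>z\<^sup>2\<close> the polynomial becomes \<open>- 1/2 - lam / z + K / z\<^sup>2\<close>, which increases with
  \<open>z < 0\<close>; so its negative value at \<open>z = m\<close>, called \<open>- 2 * c\<close>, bounds it for all \<open>z \<le> m\<close>. The
  factor \<open>2\<close> lets a comparison with \<open>z' = - c * z\<^sup>2\<close> keep half of the decay for error terms.\<close>

lemma riccati_barrier:
  fixes lam K m :: real
  assumes lam: "lam > 0" and K: "K \<ge> 0" and m: "m < - lam - sqrt (lam\<^sup>2 + 2 * K)"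
  obtains c where "c > 0" "\<And>z. z \<le> m \<Longrightarrow> - z\<^sup>2 / 2 - lam * z + K \<le> - 2 * c * z\<^sup>2"
proof -
  define P where "P z = - z\<^sup>2 / 2 - lam * z + K" for z
  have "sqrt (lam\<^sup>2 + 2 * K) < - (m + lam)" using m by simp
  then have "lam\<^sup>2 + 2 * K < (- (m + lam))\<^sup>2"
    using real_less_rsqrt real_sqrt_less_iff K by (smt (verit) real_sqrt_abs real_sqrt_ge_zero zero_le_power2)
  then have Pm: "P m < 0" by (simp add: P_def power2_eq_square field_simps)
  have m0: "m < 0" using m lam real_sqrt_ge_zero[of "lam\<^sup>2 + 2 * K"] K by (smt (verit) zero_le_power2)
  define c where "c = - P m / (2 * m\<^sup>2)"
  have "P z \<le> - 2 * c * z\<^sup>2" if z: "z \<le> m" for z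
  proof -
    have z0: "z < 0" using z m0 by simp
    have "0 \<le> lam * ((z * m) * (m - z))"
      using lam z z0 m0 by (intro mult_nonneg_nonneg mult_nonpos_nonpos) auto
    moreover have "m\<^sup>2 \<le> z\<^sup>2" using z m0 by (metis abs_le_square_iff abs_of_neg z0 neg_le_iff_le)
    then have "K * m\<^sup>2 \<le> K * z\<^sup>2" using K by (rule mult_left_mono)
    ultimately have "P z * m\<^sup>2 \<le> P m * z\<^sup>2"
      by (simp add: P_def algebra_simps power2_eq_square)
    then have "P z \<le> P m * z\<^sup>2 / m\<^sup>2" using m0 by (simp add: pos_le_divide_eq)
    also have "\<dots> = - 2 * c * z\<^sup>2" using m0 by (simp add: c_def)
    finally show ?thesis .
  qed
  moreover have "c > 0" using Pm m0 by (simp add: c_def divide_neg_pos)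
  ultimately show thesis using that unfolding P_def by blast
qed

text \<open>The minimum over \<open>x\<close> of the difference quotient \<open>g t x = (v t (x + h) - v t x) / h\<close> stays below the
  solution \<open>Z\<close> of \<open>Z' = - c * Z\<^sup>2\<close>, which tends to \<open>-\<infinity>\<close> at time \<open>a / c\<close>, whereas \<open>g\<close> is bounded on
  \<open>[0, a / c]\<close>.

  Difference quotients are used because \<open>v\<close> is only once differentiable in \<open>x\<close>. Working at a
  minimiser \<open>x\<close> instead of along characteristics avoids solving an ordinary differential equation:
  there \<open>vx t (x + h) = vx t x = q\<close>, so the transport term contributes exactly \<open>- q * g\<close> to the time
  derivative of \<open>g\<close>, and the forcing contributes \<open>Rx t \<xi>\<close> for some \<open>\<xi>\<close> between \<open>x\<close> and
  \<open>x + h\<close>. By uniform continuity of \<open>vx\<close>, a small \<open>h\<close> makes \<open>q\<close>, \<open>vx t \<xi>\<close> and \<open>g\<close> agree up to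
  \<open>e\<close>, which yields the Riccati inequality up to an error of order \<open>e\<close>.\<close>

lemma steep_slope_excludes_global_solution:
  fixes v vx vt R Rx :: "real \<Rightarrow> real \<Rightarrow> real"
  assumes lam: "lam > 0" and K: "K \<ge> 0"
    and per: "\<And>t x. t \<ge> 0 \<Longrightarrow> v t (x + 1) = v t x"
    and der_x: "\<And>t x. t \<ge> 0 \<Longrightarrow> (v t has_real_derivative vx t x) (at x)"
    and der_t: "\<And>t x. t \<ge> 0 \<Longrightarrow> ((\<lambda>\<tau>. v \<tau> x) has_real_derivative vt t x) (at t within {0..})"
    and eq: "\<And>t x. t \<ge> 0 \<Longrightarrow> vt t x + v t x * vx t x = R t x"
    and der_R: "\<And>t x. t \<ge> 0 \<Longrightarrow> (R t has_real_derivative Rx t x) (at x)"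
    and R_le: "\<And>t x. t \<ge> 0 \<Longrightarrow> Rx t x \<le> (vx t x)\<^sup>2 / 2 - lam * vx t x + K"
    and cont: "continuous_on ({0..} \<times> UNIV) (\<lambda>(t, x). v t x)"
    and cont_x: "continuous_on ({0..} \<times> UNIV) (\<lambda>(t, x). vx t x)"
    and init: "vx 0 x0 < - lam - sqrt (lam\<^sup>2 + 2 * K)"
  shows False
proof -
  have perx: "vx t (x + 1) = vx t x" if "t \<ge> 0" for t x
  proof (rule DERIV_unique)
    show "(v t has_real_derivative vx t x) (at x)" by (rule der_x[OF that])
    have "((\<lambda>y. v t (y + 1)) has_real_derivative vx t (x + 1)) (at x)"
      using der_x[OF that, of "x + 1"] by (simp add: DERIV_shift)
    then show "(v t has_real_derivative vx t (x + 1)) (at x)" by (simp add: per that)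
  qed
  obtain m where m: "vx 0 x0 < m" "m < - lam - sqrt (lam\<^sup>2 + 2 * K)" using dense[OF init] by blast
  obtain c where c: "c > 0" and barrier: "\<And>z. z \<le> m \<Longrightarrow> - z\<^sup>2 / 2 - lam * z + K \<le> - 2 * c * z\<^sup>2"
    using riccati_barrier[OF lam K m(2)] by metis
  have m0: "m < 0" using m lam real_sqrt_ge_zero[of "lam\<^sup>2 + 2 * K"] K by (smt (verit) zero_le_power2)
  define a where "a = - 1 / m"
  have a: "a > 0" using m0 by (simp add: a_def)
  let ?Q = "{0..a / c} \<times> {0..2::real}"
  have cQ: "compact ?Q" by (intro compact_Times compact_Icc)
  have contQ: "continuous_on ?Q (\<lambda>(t, x). vx t x)"
    by (rule continuous_on_subset[OF cont_x]) auto
  obtain M where M: "M \<ge> 0" "\<And>t x. (t, x) \<in> ?Q \<Longrightarrow> \<bar>vx t x\<bar> \<le> M"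
  proof -
    have "bounded ((\<lambda>(t, x). vx t x) ` ?Q)"
      by (intro compact_imp_bounded compact_continuous_image contQ cQ)
    then obtain B where B: "\<forall>y\<in>(\<lambda>(t, x). vx t x) ` ?Q. norm y \<le> B"
      unfolding bounded_iff by blast
    have "\<bar>vx t x\<bar> \<le> \<bar>B\<bar>" if "(t, x) \<in> ?Q" for t x
      using bspec[OF B imageI[OF that]] by simp
    then show thesis using that[of "\<bar>B\<bar>"] by simp
  qed
  \<comment> \<open>\<open>Z\<close> starts at \<open>m\<close> and reaches \<open>- N\<close>, below every slope, at time \<open>t1\<close>.\<close>
  define N where "N = M + 1 + 1 / a"
  have N: "N > M" "N > 0" "1 / N < a"
  proof -
    have "1 / a > 0" using a by simp
    then show "N > M" "N > 0" using M(1) unfolding N_def by linarith+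
    have "1 / N < 1 / (1 / a)"
      using \<open>1 / a > 0\<close> \<open>N > 0\<close> M(1) by (intro divide_strict_left_mono) (auto simp: N_def)
    then show "1 / N < a" by simp
  qed
  define t1 where "t1 = (a - 1 / N) / c"
  have t1: "t1 > 0" "t1 \<le> a / c" using N c by (auto simp: t1_def divide_right_mono)
  define Z where "Z t = - 1 / (a - c * t)" for t
  have act: "1 / N \<le> a - c * t" "a - c * t \<le> a" "a - c * t > 0" if "0 \<le> t" "t \<le> t1" for t
  proof -
    have "c * t \<le> c * t1" using that c by simp
    also have "\<dots> = a - 1 / N" using c by (simp add: t1_def)
    finally show "1 / N \<le> a - c * t" by simp
    with N(2) show "a - c * t > 0" by (smt (verit) divide_pos_pos)
    show "a - c * t \<le> a" using that c by simp
  qed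
  have Zm: "Z t \<le> m" if "0 \<le> t" "t \<le> t1" for t
  proof -
    have "1 / a \<le> 1 / (a - c * t)" using act[OF that] a by (intro divide_left_mono) auto
    then show ?thesis using m0 by (simp add: Z_def a_def)
  qed
  have Zder: "(Z has_real_derivative - c * (Z t)\<^sup>2) (at t within S)" if "0 \<le> t" "t \<le> t1" for t S
    unfolding Z_def using act(3)[OF that]
    by (auto intro!: derivative_eq_intros simp: power2_eq_square)
  \<comment> \<open>The first bound makes the minimum of \<open>g 0\<close> at most \<open>m\<close>; the second makes the error smaller than the spare decay \<open>c * m\<^sup>2\<close>.\<close>
  define e where "e = min (m - vx 0 x0) (c * m\<^sup>2 / (2 * (2 * M + lam)))"
  have e: "e > 0" "e \<le> m - vx 0 x0" and e2: "e * (2 * M + lam) < c * m\<^sup>2"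
  proof -
    have D: "2 * M + lam > 0" using M lam by simp
    have cm: "c * m\<^sup>2 > 0" using c m0 by simp
    show "e > 0" "e \<le> m - vx 0 x0" using m cm D by (auto simp: e_def)
    have "e * (2 * M + lam) \<le> c * m\<^sup>2 / (2 * (2 * M + lam)) * (2 * M + lam)"
      using D by (intro mult_right_mono) (auto simp: e_def)
    also have "\<dots> = c * m\<^sup>2 / 2" using D by (simp add: field_simps)
    finally show "e * (2 * M + lam) < c * m\<^sup>2" using cm by simp
  qed
  obtain d where d: "d > 0" "\<And>p q. p \<in> ?Q \<Longrightarrow> q \<in> ?Q \<Longrightarrow> dist q p < d \<Longrightarrow>
      dist ((\<lambda>(t, x). vx t x) q) ((\<lambda>(t, x). vx t x) p) < e"
    using compact_uniformly_continuous[OF contQ cQ] e(1) unfolding uniformly_continuous_on_def by metis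
  have vx_close: "\<bar>vx t x - vx t y\<bar> < e" if "t \<in> {0..a / c}" "x \<in> {0..2}" "y \<in> {0..2}" "\<bar>x - y\<bar> < d" for t x y
    using d(2)[of "(t, y)" "(t, x)"] that by (simp add: dist_Pair_Pair dist_real_def)
  define h where "h = min 1 (d / 2)"
  have h: "h > 0" "h \<le> 1" "h < d" using d(1) by (auto simp: h_def)
  define g where "g t x = (v t (x + h) - v t x) / h" for t x
  have mean_value: "\<bar>g t x\<bar> \<le> M \<and> (\<forall>y\<in>{x..x+h}. \<bar>vx t y - g t x\<bar> \<le> e)"
    if t: "t \<in> {0..a / c}" and x: "x \<in> {0..1}" for t x
  proof -
    have t0: "t \<ge> 0" using t by simp
    obtain y where y: "x < y" "y < x + h" "v t (x + h) - v t x = (x + h - x) * vx t y"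
      using MVT2[of x "x + h" "v t" "vx t"] der_x[OF t0] h by auto
    have gy: "g t x = vx t y" using y h by (simp add: g_def)
    have "\<bar>vx t z - vx t y\<bar> < e" if "z \<in> {x..x+h}" for z
      by (rule vx_close[OF t]) (use x y h that in auto)
    moreover have "\<bar>vx t y\<bar> \<le> M" using t x y h by (intro M(2)) auto
    ultimately show ?thesis unfolding gy by (auto intro: less_imp_le)
  qed
  \<comment> \<open>\<open>S\<close> is closed, contains \<open>0\<close>, and has no greatest element below \<open>t1\<close>; hence it contains \<open>t1\<close>.\<close>
  define S where "S = {t \<in> {0..t1}. \<exists>x\<in>{0..1}. g t x \<le> Z t}"
  have cont_v: "continuous_on ({0..t1} \<times> {0..1::real}) (\<lambda>p. v (fst p) (snd p + b))" for b
  proof -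
    have "continuous_on ({0..t1} \<times> {0..1::real}) (\<lambda>p. (\<lambda>(t, x). v t x) (fst p, snd p + b))"
      by (rule continuous_on_compose2[OF cont]) (auto intro!: continuous_intros)
    then show ?thesis by simp
  qed
  have cont_g: "continuous_on ({0..t1} \<times> {0..1::real}) (\<lambda>p. g (fst p) (snd p))"
    unfolding g_def using cont_v[of h] cont_v[of 0] h by (auto intro!: continuous_intros)
  have cont_Z: "continuous_on ({0..t1} \<times> {0..1::real}) (\<lambda>p. Z (fst p))"
    unfolding Z_def using act(3) by (force intro!: continuous_intros)
  have "compact {p \<in> {0..t1} \<times> {0..1}. g (fst p) (snd p) \<le> Z (fst p)}" (is "compact ?G")
  proof -
    have "closed ?G"
      by (intro continuous_on_closed_Collect_le cont_g cont_Z closed_Times closed_atLeastAtMost)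
    then show ?thesis
      using compact_Int_closed[of "{0..t1} \<times> {0..1::real}" ?G]
      by (auto simp: compact_Times Int_absorb1 subset_iff Collect_conj_eq)
  qed
  then have "compact (fst ` ?G)" by (intro compact_continuous_image continuous_intros)
  moreover have "fst ` ?G = S" by (force simp: S_def)
  ultimately have cS: "compact S" by simp
  have S0: "0 \<in> S"
  proof -
    have fr: "frac x0 \<in> {0..1}" using frac_lt_1[of x0] by (simp add: less_imp_le)
    have "\<bar>vx 0 (frac x0) - g 0 (frac x0)\<bar> \<le> e" using mean_value[OF _ fr, of 0] a c h by auto
    moreover have "vx 0 (frac x0) = vx 0 x0" by (rule periodic_frac) (simp add: perx)
    ultimately have "g 0 (frac x0) \<le> m" using e by linarith
    moreover have "Z 0 = m" by (simp add: Z_def a_def)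
    ultimately show ?thesis using fr t1 by (auto simp: S_def)
  qed
  have extend: "\<exists>\<tau>\<in>S. \<tau> > t" if tS: "t \<in> S" and tt1: "t < t1" for t
  proof -
    have t: "0 \<le> t" "t \<le> t1" using tS by (auto simp: S_def)
    have tQ: "t \<in> {0..a / c}" using t t1 by simp
    have g_der: "(g t has_real_derivative (vx t (y + h) - vx t y) / h) (at y)" for y
    proof -
      have "((\<lambda>y. v t (y + h)) has_real_derivative vx t (y + h)) (at y)"
        using der_x[OF t(1), of "y + h"] by (simp add: DERIV_shift)
      from DERIV_cdivide[OF DERIV_diff[OF this der_x[OF t(1)]], of h] show ?thesis
        by (simp add: g_def[abs_def])
    qed
    have "continuous_on {0..1} (g t)"
      by (rule DERIV_continuous_on[OF has_field_derivative_at_within[OF g_der]])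
    then obtain x where x: "x \<in> {0..1}" "\<And>y. y \<in> {0..1} \<Longrightarrow> g t x \<le> g t y"
      using continuous_attains_inf[OF compact_Icc, of 0 1 "g t"] by auto
    have min: "g t x \<le> g t y" for y
    proof -
      have "g t (z + 1) = g t z" for z
        using per[OF t(1), of "z + h"] per[OF t(1), of z] by (simp add: g_def add_ac)
      then have "g t (frac y) = g t y" by (rule periodic_frac)
      then show ?thesis using x(2)[of "frac y"] frac_lt_1[of y] by (simp add: less_imp_le)
    qed
    have gZ: "g t x \<le> Z t" using tS min unfolding S_def by (auto intro: order_trans)
    define q where "q = vx t x"
    have "(vx t (x + h) - vx t x) / h = 0"
      by (rule DERIV_local_min[OF g_der, of 1]) (auto simp: min)
    then have q: "vx t (x + h) = q" using h by (simp add: q_def)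
    define D where "D = (vt t (x + h) - vt t x) / h + c * (Z t)\<^sup>2"
    have phi: "((\<lambda>\<tau>. g \<tau> x - Z \<tau>) has_real_derivative D) (at t within {0..})"
      unfolding g_def D_def using h der_t[OF t(1), of "x + h"] der_t[OF t(1), of x] Zder[OF t]
      by (auto intro!: derivative_eq_intros)
    \<comment> \<open>Below the barrier, continuity suffices; on the barrier, \<open>g - Z\<close> has a negative derivative in time.\<close>
    have "\<exists>\<delta>>0. \<forall>\<tau>. t < \<tau> \<and> \<tau> < t + \<delta> \<longrightarrow> g \<tau> x < Z \<tau>"
    proof (cases "g t x < Z t")
      case True
      have "((\<lambda>\<tau>. g \<tau> x - Z \<tau>) \<longlongrightarrow> g t x - Z t) (at t within {0..})"
        using DERIV_continuous[OF phi] by (simp add: continuous_within)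
      then have "\<forall>\<^sub>F \<tau> in at t within {0..}. g \<tau> x - Z \<tau> < 0"
        by (rule order_tendstoD) (use True in simp)
      then obtain \<delta> where "\<delta> > 0" "\<forall>\<tau>\<in>{0..}. \<tau> \<noteq> t \<and> dist \<tau> t < \<delta> \<longrightarrow> g \<tau> x - Z \<tau> < 0"
        unfolding eventually_at by auto
      then show ?thesis using t by (intro exI[of _ \<delta>]) (auto simp: dist_real_def)
    next
      case False
      with gZ have z: "g t x = Z t" by simp
      define z where "z = g t x"
      \<comment> \<open>The letters \<open>z\<close>, \<open>p\<close>, \<open>q\<close> stand for the three nearly equal slopes of the Riccati inequality.\<close>
      obtain \<xi> where \<xi>: "x < \<xi>" "\<xi> < x + h" "R t (x + h) - R t x = (x + h - x) * Rx t \<xi>"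
        using MVT2[of x "x + h" "R t" "Rx t"] der_R[OF t(1)] h by auto
      define p where "p = vx t \<xi>"
      have mv: "\<bar>z\<bar> \<le> M" "\<bar>p - z\<bar> \<le> e" "\<bar>q - z\<bar> \<le> e"
        using mean_value[OF tQ x(1)] \<xi> h by (auto simp: z_def p_def q_def)
      have pM: "\<bar>p\<bar> \<le> M" unfolding p_def using x \<xi> h tQ by (intro M(2)) auto
      have "vt t (x + h) - vt t x = (R t (x + h) - R t x) - q * (v t (x + h) - v t x)"
        using eq[OF t(1), of "x + h"] eq[OF t(1), of x] q by (simp add: q_def algebra_simps)
      also have "\<dots> = h * (Rx t \<xi> - q * z)"
      proof -
        have "R t (x + h) - R t x = h * Rx t \<xi>" using \<xi>(3) by simp
        moreover have "v t (x + h) - v t x = h * z" using h by (simp add: z_def g_def)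
        ultimately show ?thesis by (simp add: right_diff_distrib mult.left_commute)
      qed
      finally have "(vt t (x + h) - vt t x) / h = Rx t \<xi> - q * z" using h by simp
      also have "\<dots> \<le> p\<^sup>2 / 2 - lam * p + K - q * z" using R_le[OF t(1), of \<xi>] by (simp add: p_def)
      also have "\<dots> = (- z\<^sup>2 / 2 - lam * z + K) + (p - z) * (p + z) / 2 + lam * (z - p) + (z - q) * z"
        by (simp add: power2_eq_square field_simps)
      also have "\<dots> \<le> - 2 * c * z\<^sup>2 + e * M + lam * e + e * M"
      proof (intro add_mono)
        show "- z\<^sup>2 / 2 - lam * z + K \<le> - 2 * c * z\<^sup>2" using Zm[OF t] z by (intro barrier) (simp add: z_def)
        have "(p - z) * (p + z) \<le> \<bar>p - z\<bar> * \<bar>p + z\<bar>" by (metis abs_ge_self abs_mult)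
        also have "\<dots> \<le> e * (2 * M)" using mv pM by (intro mult_mono) auto
        finally show "(p - z) * (p + z) / 2 \<le> e * M" by simp
        show "lam * (z - p) \<le> lam * e" using mv lam by (intro mult_left_mono) auto
        have "(z - q) * z \<le> \<bar>z - q\<bar> * \<bar>z\<bar>" by (metis abs_ge_self abs_mult)
        also have "\<dots> \<le> e * M" using mv by (intro mult_mono) auto
        finally show "(z - q) * z \<le> e * M" .
      qed
      finally have "D \<le> - c * z\<^sup>2 + e * (2 * M + lam)"
        unfolding D_def using z by (simp add: z_def algebra_simps)
      also have "\<dots> < - c * z\<^sup>2 + c * m\<^sup>2" using e2 by simp
      also have "\<dots> \<le> 0"
      proof -
        have "z \<le> m" using Zm[OF t] z by (simp add: z_def)
        then have "m\<^sup>2 \<le> z\<^sup>2" using m0 by (simp add: abs_le_square_iff[symmetric])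
        then show ?thesis using c by simp
      qed
      finally have "D < 0" .
      from has_real_derivative_neg_dec_right[OF phi this]
      obtain \<delta> where \<delta>: "\<delta> > 0" "\<And>k. k > 0 \<Longrightarrow> t + k \<in> {0..} \<Longrightarrow> k < \<delta> \<Longrightarrow> g t x - Z t > g (t + k) x - Z (t + k)"
        by auto
      show ?thesis
      proof (intro exI conjI allI impI)
        fix \<tau> assume "t < \<tau> \<and> \<tau> < t + \<delta>"
        then show "g \<tau> x < Z \<tau>" using \<delta>(2)[of "\<tau> - t"] t z by simp
      qed (rule \<delta>(1))
    qed
    then obtain \<delta> where \<delta>: "\<delta> > 0" "\<And>\<tau>. t < \<tau> \<Longrightarrow> \<tau> < t + \<delta> \<Longrightarrow> g \<tau> x < Z \<tau>" by auto
    define \<tau> where "\<tau> = min t1 (t + \<delta> / 2)"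
    have "t < \<tau>" "\<tau> < t + \<delta>" "\<tau> \<le> t1" using \<delta>(1) tt1 by (auto simp: \<tau>_def)
    then show ?thesis using \<delta>(2)[of \<tau>] x(1) t by (intro bexI[of _ \<tau>]) (auto simp: S_def intro!: bexI[of _ x])
  qed
  obtain t where t: "t \<in> S" "\<And>\<tau>. \<tau> \<in> S \<Longrightarrow> \<tau> \<le> t"
    using compact_attains_sup[OF cS] S0 by blast
  have "t = t1" using extend[OF t(1)] t by (force simp: S_def)
  then obtain x where x: "x \<in> {0..1}" "g t1 x \<le> Z t1" using t by (auto simp: S_def)
  have "Z t1 = - N" using c N by (simp add: Z_def t1_def)
  moreover have "\<bar>g t1 x\<bar> \<le> M" using mean_value[OF _ x(1), of t1] t1 by auto
  ultimately show False using x(2) N(1) by linarith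
qed

theorem theorem4p2:
  fixes lam s mu0 mu1 K :: real
    and u0 :: "real \<Rightarrow> real"
    and u :: "real \<Rightarrow> real \<Rightarrow> real"
    and T :: ereal
  assumes "lam > 0"
    and "s > 3 / 2"
    and "u0 \<in> sobolev s"
    and "muHS_maximal_solution s lam u0 T u"
    and "mu0 = mean u0"
    and "mu1 = sqrt (integral {0..1} (\<lambda>x. (deriv u0 x)\<^sup>2))"
    and "K = 2 * \<bar>mu0\<bar> * (\<bar>mu0\<bar> + sqrt 3 / 6 * mu1)"
    and "(INF x. deriv u0 x) < - lam - sqrt (lam\<^sup>2 + 2 * K)"
  shows "T < \<infinity>"
proof (rule ccontr)
  assume "\<not> T < \<infinity>"
  then have "T = \<infinity>" by simp
  note s = \<open>s > 3 / 2\<close>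
  have s1: "s - 1 > 1 / 2" and s': "s > 1 / 2" using s by auto
  have I: "{t. 0 \<le> t \<and> ereal t < T} = {0..}" using \<open>T = \<infinity>\<close> by auto
  from assms(4) have "muHS_solution s lam u0 T u" by (simp add: muHS_maximal_solution_def)
  then obtain ut where u0: "u 0 = u0" and cu: "sobolev_continuous_on s {0..} u"
    and C1: "sobolev_C1_on (s - 1) {0..} u ut"
    and eq: "\<And>t x. 0 \<le> t \<Longrightarrow> ut t x + u t x * deriv (u t) x = muHS_rhs s lam mu0 t (u t) x"
    unfolding muHS_solution_def I using \<open>T = \<infinity>\<close> assms(5) by auto
  have sob: "u t \<in> sobolev s" if "t \<ge> 0" for t
    using cu that by (simp add: sobolev_continuous_on_def)
  have "integral {0..1} (\<lambda>x. (deriv u0 x)\<^sup>2) \<ge> 0"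
    using continuous_on_subset[OF sobolevD(1)[OF deriv_in_sobolev[OF s assms(3)]]]
    by (intro integral_nonneg integrable_continuous_real continuous_intros) auto
  then have "0 \<le> 2 * \<bar>mu0\<bar> * (sqrt 3 / 6 * mu1)"
    unfolding assms(6) by (intro mult_nonneg_nonneg) auto
  then have K: "2 * mu0\<^sup>2 \<le> K"
    unfolding assms(7) distrib_left by (simp add: power2_eq_square)
  obtain x0 where x0: "deriv u0 x0 < - lam - sqrt (lam\<^sup>2 + 2 * K)"
    using cInf_lessD[OF _ assms(8)] by auto
  define source where "source t z = 2 * mu0 * exp (- lam * t) * u t z + 1 / 2 * (deriv (u t) z)\<^sup>2" for t z
  show False
  proof (rule steep_slope_excludes_global_solution[where v = u and vx = "\<lambda>t. deriv (u t)" and vt = ut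
        and R = "\<lambda>t. muHS_rhs s lam mu0 t (u t)"
        and Rx = "\<lambda>t x. source t x - mean (source t) - lam * deriv (u t) x" and lam = lam and K = K])
    show "K \<ge> 0" using K by (smt (verit) zero_le_power2)
    fix t x :: real assume t: "t \<ge> 0"
    show "u t (x + 1) = u t x" by (rule sobolevD(2)[OF sob[OF t]])
    show "(u t has_real_derivative deriv (u t) x) (at x)" by (rule sobolev_has_derivative[OF s sob[OF t]])
    show "((\<lambda>\<tau>. u \<tau> x) has_real_derivative ut t x) (at t within {0..})"
      by (rule sobolev_C1_on_has_derivative[OF s1 C1]) (use t in simp)
    show "ut t x + u t x * deriv (u t) x = muHS_rhs s lam mu0 t (u t) x" by (rule eq[OF t])
    show "(muHS_rhs s lam mu0 t (u t) has_real_derivative source t x - mean (source t) - lam * deriv (u t) x) (at x)"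
      unfolding source_def by (rule muHS_rhs_has_derivative[OF s sob[OF t]])
    show "source t x - mean (source t) - lam * deriv (u t) x \<le> (deriv (u t) x)\<^sup>2 / 2 - lam * deriv (u t) x + K"
      using muHS_source_bound[OF s sob[OF t], of lam t mu0 x] assms(1) t K unfolding source_def by simp
  next
    show "continuous_on ({0..} \<times> UNIV) (\<lambda>(t, x). u t x)"
      by (rule sobolev_continuous_on_imp_continuous[OF s' cu])
    show "continuous_on ({0..} \<times> UNIV) (\<lambda>(t, x). deriv (u t) x)"
      by (rule sobolev_continuous_on_imp_continuous[OF s1 sobolev_continuous_on_deriv[OF s cu]])
    show "deriv (u 0) x0 < - lam - sqrt (lam\<^sup>2 + 2 * K)" using x0 u0 by simp
  qed (rule assms(1))
qed

end
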